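(* Let $E$ be a closed subset of $\hat{\mathbb{C}}$ that is not a subset of a circle in $\hat{\mathbb{C}}$, and suppose there exists $\lambda\in(0,1)$ such that $$\sum_{j=1}^\infty \lambda^j P_{\lambda^j}(E)=\infty .$$ Then the hyperbolic volume of the hyperbolic convex hull $CH(E)\subset\mathbb{H}^3$ is infinite.
   Context: $\mathbb{H}^3$ is hyperbolic 3-space, whose sphere at infinity is identified with the Riemann sphere $\hat{\mathbb{C}}=\mathbb{C}\cup\{\infty\}$. A circle in $\hat{\mathbb{C}}$ is a round circle in $\mathbb{C}$ or a Euclidean line in $\mathbb{C}$ together with $\infty$. For a closed set $E\subset\hat{\mathbb{C}}$, the hyperbolic convex hull $CH(E)\subset\mathbb{H}^3$ is the hyperbolic convex hull of the union of all hyperbolic geodesics in $\mathbb{H}^3$ both of whose endpoints at infinity lie in $E$. For $E\subset\hat{\mathbb{C}}$ and $\epsilon>0$, the packing number $P_\epsilon(E)$ is the maximum number of pairwise disjoint balls of radius $\epsilon$ with centers in $E$, where balls are taken with respect to the spherical metric on $\hat{\mathbb{C}}$. *)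

theory Defs
  imports "HOL-Analysis.Analysis"
begin

type_synonym riemann_sphere = "complex option"

text \<open>\<open>Some z\<close> is the finite point \<open>z\<close> and \<open>None\<close> is the point at infinity.\<close>

abbreviation riemann_sphere_topology :: "riemann_sphere topology" where
  "riemann_sphere_topology \<equiv> Alexandroff_compactification euclidean"

definition sphere_circle :: "riemann_sphere set \<Rightarrow> bool" where
  "sphere_circle C \<longleftrightarrow>
     (\<exists>c r. 0 < r \<and> C = Some ` sphere c r) \<or>
     (\<exists>a v. v \<noteq> 0 \<and> C = insert None (Some ` range (\<lambda>t::real. a + of_real t * v)))"


subsection \<open>Spherical metric and packing numbers\<close>

definition stereographic_inv :: "riemann_sphere \<Rightarrow> complex \<times> real" where
  "stereographic_inv x = (case x of
       None \<Rightarrow> (0, 1)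
     | Some z \<Rightarrow> ((2 / (1 + (cmod z)\<^sup>2)) *\<^sub>R z, ((cmod z)\<^sup>2 - 1) / ((cmod z)\<^sup>2 + 1)))"

text \<open>Great-circle distance on the unit sphere, i.e. the metric with length element
  \<open>2 |dz| / (1 + |z|\<^sup>2)\<close>.\<close>

definition spherical_dist :: "riemann_sphere \<Rightarrow> riemann_sphere \<Rightarrow> real" where
  "spherical_dist x y = arccos (stereographic_inv x \<bullet> stereographic_inv y)"

definition spherical_ball :: "riemann_sphere \<Rightarrow> real \<Rightarrow> riemann_sphere set" where
  "spherical_ball x \<epsilon> = {y. spherical_dist x y < \<epsilon>}"

text \<open>For \<open>\<epsilon> > 0\<close> disjoint balls have distinct centres, so the set of centres counts the balls,
  and by compactness of the sphere the supremum is finite, hence a maximum.\<close>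

definition packing_number :: "real \<Rightarrow> riemann_sphere set \<Rightarrow> enat" where
  "packing_number \<epsilon> E =
     (SUP F \<in> {F. finite F \<and> F \<subseteq> E \<and> disjoint_family_on (\<lambda>x. spherical_ball x \<epsilon>) F}. enat (card F))"


subsection \<open>Hyperbolic 3-space: the upper half-space model\<close>

definition hyp_space :: "(complex \<times> real) set" where
  "hyp_space = {p. 0 < snd p}"

text \<open>The distance induced by the length element \<open>sqrt (|dz|\<^sup>2 + dt\<^sup>2) / t\<close>; \<open>dist\<close> is Euclidean.\<close>

definition hyp_dist :: "complex \<times> real \<Rightarrow> complex \<times> real \<Rightarrow> real" where
  "hyp_dist p q = arcosh (1 + (dist p q)\<^sup>2 / (2 * snd p * snd q))"

definition hyp_geodesic :: "(real \<Rightarrow> complex \<times> real) \<Rightarrow> bool" where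
  "hyp_geodesic g \<longleftrightarrow> range g \<subseteq> hyp_space \<and> (\<forall>s u. hyp_dist (g s) (g u) = \<bar>s - u\<bar>)"

text \<open>Convergence to a point of the sphere at infinity, in the compactification of the closed
  half-space \<open>t \<ge> 0\<close> by one point.\<close>

definition tends_to_ideal ::
    "('a \<Rightarrow> complex \<times> real) \<Rightarrow> riemann_sphere \<Rightarrow> 'a filter \<Rightarrow> bool" where
  "tends_to_ideal g x F \<longleftrightarrow> (case x of
       None \<Rightarrow> filterlim g at_infinity F
     | Some a \<Rightarrow> (g \<longlongrightarrow> (a, 0)) F)"

definition hyp_segment :: "complex \<times> real \<Rightarrow> complex \<times> real \<Rightarrow> (complex \<times> real) set" where
  "hyp_segment p q = {x \<in> hyp_space. hyp_dist p x + hyp_dist x q = hyp_dist p q}"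

definition hyp_convex :: "(complex \<times> real) set \<Rightarrow> bool" where
  "hyp_convex S \<longleftrightarrow> S \<subseteq> hyp_space \<and> (\<forall>p\<in>S. \<forall>q\<in>S. hyp_segment p q \<subseteq> S)"

definition CH :: "riemann_sphere set \<Rightarrow> (complex \<times> real) set" where
  "CH E = hyp_convex hull
     \<Union> {range g | g. hyp_geodesic g \<and>
            (\<exists>x\<in>E. \<exists>y\<in>E. tends_to_ideal g x at_bot \<and> tends_to_ideal g y at_top)}"

definition hyp_volume :: "(complex \<times> real) set \<Rightarrow> ennreal" where
  "hyp_volume A = (\<integral>\<^sup>+p\<in>A \<inter> hyp_space. ennreal (1 / snd p ^ 3) \<partial>lborel)"

text \<open>For Borel sets, in particular for \<open>CH E\<close> with \<open>E\<close> closed, this is the measure with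
  density \<open>t\<^sup>-\<^sup>3\<close> on the half-space.\<close>

lemma hyp_volume_eq_emeasure:
  assumes "A \<in> sets borel"
  shows "hyp_volume A =
    emeasure (density lborel (\<lambda>p. ennreal (1 / snd p ^ 3) * indicator hyp_space p)) A"
proof -
  have "hyp_space = snd -` {0<..} \<inter> space borel"
    by (auto simp: hyp_space_def)
  then have [measurable]: "hyp_space \<in> sets borel"
    using measurable_sets[of "snd :: complex \<times> real \<Rightarrow> real" borel borel "{0<..}"]
    by (simp add: borel_measurable_continuous_onI continuous_on_snd)
  have [measurable]: "(snd :: complex \<times> real \<Rightarrow> real) \<in> borel_measurable borel"
    by (intro borel_measurable_continuous_onI continuous_intros)
  have m: "(\<lambda>p. ennreal (1 / snd p ^ 3) * indicator hyp_space p)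
      \<in> borel_measurable (lborel :: (complex \<times> real) measure)"
    by measurable
  show ?thesis
    using assms unfolding hyp_volume_def
    by (subst emeasure_density[OF m]) (auto intro!: nn_integral_cong simp: indicator_def)
qed

end

theory Submission
  imports Defs
begin

text \<open>
  Two points \<open>x, y\<close> of \<open>E\<close> at distance about \<open>\<delta>\<close> contribute hyperbolic volume about \<open>\<delta>\<close> to the hull at
  height about \<open>\<delta>\<close>: as \<open>E\<close> is not contained in a circle, the hull contains a fixed ball, and the join
  of this ball with the geodesic from \<open>x\<close> to \<open>y\<close> has hyperbolic size \<open>1 \<times> 1 \<times> \<delta>\<close> there. If \<open>N\<^sub>j\<close> is the
  largest size of a \<open>\<lambda>\<^sup>j\<close>-separated subset of \<open>E\<close>, there are at least \<open>N\<^sub>j\<^sub>+\<^sub>1 - N\<^sub>j\<close> points with a partner at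
  distance about \<open>\<lambda>\<^sup>j\<close>, and the corresponding regions overlap boundedly, both within a level and
  across levels. So the volume is at least a constant times \<open>\<Sum> \<lambda>\<^sup>j (N\<^sub>j\<^sub>+\<^sub>1 - N\<^sub>j)\<close>, which diverges together
  with \<open>\<Sum> \<lambda>\<^sup>j N\<^sub>j\<close> by summation by parts. The part of \<open>E\<close> outside the unit disc is moved into it by an inversion.
\<close>

subsection \<open>Straightening hyperbolic segments and the convex hull\<close>

text \<open>The join is controlled quantitatively where it is Euclidean: in the paraboloid picture
  the vertical distance of a point to the paraboloid is its squared height. Mixing the middle of a
  chord of horizontal length \<delta> with a point of the fixed ball, the latter with weight
  \<open>s\<close>, gives squared height of order \<open>\<delta>\<^sup>2 + s\<close>. So
  \<open>\<delta>\<^sup>2\<close> is the largest order of weight that keeps the height near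
  \<delta>; the ball then supplies thickness \<open>\<delta>\<^sup>2\<close> across the chord, and
  dividing \<open>\<delta> * \<delta> * \<delta>\<^sup>2\<close> by \<open>\<delta> ^ 3\<close>
  leaves volume \<delta>. Working inside the unit disc makes these estimates uniform in the pair and
  keeps separated sets finite. The spherical and Euclidean metrics are compared in one direction:
  spherically distant centres must be Euclidean separated, at the cost of a factor 6. The inversion
  is a spherical isometry at infinity and a hyperbolic isometry inside, so both halves of
  \<open>E\<close> are tested against the same hull.\<close>

lemma dist_prod_sq:
  fixes p q :: "complex \<times> real"
  shows "(dist p q)\<^sup>2 = (norm (fst p - fst q))\<^sup>2 + (snd p - snd q)\<^sup>2"
  by (simp add: dist_prod_def dist_norm)

text \<open>Stewart's identity. Its last term measures the convexity of the paraboloid and reappears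
  in the height of the slab centre.\<close>

lemma norm_convex_combination_sq:
  fixes a c :: "'a :: real_inner"
  shows "(norm ((1 - v) *\<^sub>R a + v *\<^sub>R c))\<^sup>2
      = (1 - v) * (norm a)\<^sup>2 + v * (norm c)\<^sup>2 - v * (1 - v) * (norm (a - c))\<^sup>2"
  unfolding power2_norm_eq_inner
  by (simp add: inner_add_left inner_add_right inner_diff_left inner_diff_right inner_commute
        algebra_simps)

text \<open>The map \<open>para\<close> straightens hyperbolic space to the convex region above a paraboloid: hyperbolic
  segments become Euclidean ones, and the ideal point \<open>a\<close> becomes the boundary point \<open>(a, |a|\<^sup>2)\<close>.\<close>

definition para :: "complex \<times> real \<Rightarrow> complex \<times> real" where
  "para p = (fst p, (norm (fst p))\<^sup>2 + (snd p)\<^sup>2)"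

lemma inj_on_para: "inj_on para hyp_space"
  by (auto simp: inj_on_def para_def hyp_space_def power2_eq_iff)

lemma hyp_dist_cosh:
  assumes "p \<in> hyp_space" "q \<in> hyp_space"
  shows "cosh (hyp_dist p q) = 1 + (dist p q)\<^sup>2 / (2 * snd p * snd q)"
    and "0 \<le> hyp_dist p q"
proof -
  have "1 \<le> 1 + (dist p q)\<^sup>2 / (2 * snd p * snd q)"
    using assms by (simp add: hyp_space_def)
  then show "cosh (hyp_dist p q) = 1 + (dist p q)\<^sup>2 / (2 * snd p * snd q)" "0 \<le> hyp_dist p q"
    by (simp_all add: hyp_dist_def cosh_arcosh_real arcosh_nonneg_real)
qed

text \<open>This is the Minkowski form of the hyperboloid model, scaled by the two heights. The
  right-hand side is affine in \<open>para p\<close> and in \<open>para q\<close> separately, which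
  makes distances to points of a chord computable.\<close>

lemma cosh_hyp_dist_para:
  assumes "p \<in> hyp_space" "q \<in> hyp_space"
  shows "2 * snd p * snd q * cosh (hyp_dist p q)
    = snd (para p) + snd (para q) - 2 * (fst (para p) \<bullet> fst (para q))"
proof -
  have "snd p \<noteq> 0" "snd q \<noteq> 0"
    using assms by (auto simp: hyp_space_def)
  then have "2 * snd p * snd q * cosh (hyp_dist p q) = 2 * snd p * snd q + (dist p q)\<^sup>2"
    by (simp add: hyp_dist_cosh[OF assms] field_simps)
  then show ?thesis
    unfolding dist_prod_sq para_def power2_norm_eq_inner
    by (simp add: inner_diff_left inner_diff_right inner_commute power2_eq_square algebra_simps)
qed

text \<open>As hyperboloid vectors, \<open>r\<close> is a nonnegative linear combination of
  \<open>p\<close> and \<open>q\<close>, hence lies between them. Additivity of the distances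
  follows from the addition formula for \<open>cosh\<close>.\<close>

lemma hyp_segment_para:
  assumes H: "p \<in> hyp_space" "q \<in> hyp_space" "r \<in> hyp_space"
    and s: "0 \<le> s" "s \<le> 1"
    and r: "para r = (1 - s) *\<^sub>R para p + s *\<^sub>R para q"
  shows "r \<in> hyp_segment p q"
proof -
  define D d1 d2 where "D = hyp_dist p q" and "d1 = hyp_dist p r" and "d2 = hyp_dist r q"
  have pos: "0 < snd p" "0 < snd q" "0 < snd r"
    using H by (auto simp: hyp_space_def)
  \<comment> \<open>The hyperboloid vector of a point is its affine lift divided by its height;
    these are the coefficients of the vector of \<open>r\<close>.\<close>
  define a b where "a = (1 - s) * snd p / snd r" and "b = s * snd q / snd r"
  have nn: "0 \<le> D" "0 \<le> d1" "0 \<le> d2" "0 \<le> a" "0 \<le> b"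
    using pos s hyp_dist_cosh(2) H by (auto simp: D_def d1_def d2_def a_def b_def)
  have self: "2 * snd u * snd u = snd (para u) + snd (para u) - 2 * (fst (para u) \<bullet> fst (para u))"
    for u
    by (simp add: para_def power2_norm_eq_inner[symmetric] power2_eq_square)
  have r1: "fst (para r) = (1 - s) *\<^sub>R fst (para p) + s *\<^sub>R fst (para q)"
    "snd (para r) = (1 - s) * snd (para p) + s * snd (para q)"
    using r by simp_all
  have e1: "snd r * cosh d1 = (1 - s) * snd p + s * snd q * cosh D"
  proof -
    have "2 * snd p * (snd r * cosh d1) = 2 * snd p * snd r * cosh d1" by simp
    also have "\<dots> = (1 - s) * (2 * snd p * snd p) + s * (2 * snd p * snd q * cosh D)"
      unfolding d1_def D_def cosh_hyp_dist_para[OF H(1,3)] cosh_hyp_dist_para[OF H(1,2)] self r1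
      by (simp add: inner_add_right algebra_simps)
    also have "\<dots> = 2 * snd p * ((1 - s) * snd p + s * snd q * cosh D)"
      by (simp add: algebra_simps)
    finally show ?thesis using pos by simp
  qed
  have e2: "snd r * cosh d2 = (1 - s) * snd p * cosh D + s * snd q"
  proof -
    have "2 * snd q * (snd r * cosh d2) = 2 * snd r * snd q * cosh d2" by simp
    also have "\<dots> = (1 - s) * (2 * snd p * snd q * cosh D) + s * (2 * snd q * snd q)"
      unfolding d2_def D_def cosh_hyp_dist_para[OF H(3,2)] cosh_hyp_dist_para[OF H(1,2)] self r1
      by (simp add: inner_add_left algebra_simps)
    also have "\<dots> = 2 * snd q * ((1 - s) * snd p * cosh D + s * snd q)"
      by (simp add: algebra_simps)
    finally show ?thesis using pos by simp
  qed
  have e3: "snd r * snd r = ((1 - s) * snd p) * ((1 - s) * snd p)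
      + 2 * ((1 - s) * snd p) * (s * snd q) * cosh D + (s * snd q) * (s * snd q)"
  proof -
    have "2 * snd r * snd r = (1 - s) * (1 - s) * (2 * snd p * snd p)
      + 2 * ((1 - s) * s) * (2 * snd p * snd q * cosh D) + s * s * (2 * snd q * snd q)"
      unfolding D_def cosh_hyp_dist_para[OF H(1,2)] self r1
      by (simp add: inner_add_left inner_add_right inner_commute algebra_simps)
    then show ?thesis by (simp add: algebra_simps)
  qed
  have c1: "cosh d1 = a + b * cosh D" and c2: "cosh d2 = a * cosh D + b"
    using e1 e2 pos by (auto simp: a_def b_def add_divide_distrib[symmetric] eq_divide_eq mult.commute)
  \<comment> \<open>The vector of \<open>r\<close> has Minkowski norm one.\<close>
  have ab: "a * a + 2 * a * b * cosh D + b * b = 1"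
  proof -
    have sub: "(1 - s) * snd p = a * snd r" "s * snd q = b * snd r"
      using pos by (simp_all add: a_def b_def)
    have "(snd r * snd r) * (a * a + 2 * a * b * cosh D + b * b) = snd r * snd r"
      using e3 unfolding sub by (simp add: algebra_simps)
    then show ?thesis using pos by simp
  qed
  have S: "(sinh u)\<^sup>2 = cosh u * cosh u - 1" for u :: real
    unfolding sinh_square_eq by (simp add: power2_eq_square)
  \<comment> \<open>Writing \<open>1\<close> as the left side of \<open>ab\<close> turns
    \<open>cosh d1 * cosh d1 - 1\<close> into \<open>b * b * (cosh D * cosh D - 1)\<close>, and
    likewise for \<open>d2\<close>.\<close>
  have "(sinh d1)\<^sup>2 = (b * sinh D)\<^sup>2" "(sinh d2)\<^sup>2 = (a * sinh D)\<^sup>2"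
    unfolding power_mult_distrib S c1 c2 using ab by (simp_all add: power2_eq_square) algebra+
  then have s12: "sinh d1 = b * sinh D" "sinh d2 = a * sinh D"
    using nn by (simp_all add: power2_eq_iff_nonneg)
  have "cosh (d1 + d2) = cosh D"
  proof -
    have "sinh D * sinh D = cosh D * cosh D - 1"
      using S[of D] by (simp add: power2_eq_square)
    then show ?thesis unfolding cosh_add c1 c2 s12 using ab by algebra
  qed
  then have "d1 + d2 = D"
    using nn by (metis arcosh_cosh_real add_nonneg_nonneg)
  then show ?thesis
    using H by (simp add: hyp_segment_def D_def d1_def d2_def)
qed

lemma para_image_hyp_space: "para ` hyp_space = {P. (norm (fst P))\<^sup>2 < snd P}"
proof (intro equalityI subsetI)
  fix P :: "complex \<times> real" assume "P \<in> {P. (norm (fst P))\<^sup>2 < snd P}"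
  then have "P = para (fst P, sqrt (snd P - (norm (fst P))\<^sup>2))"
    "(fst P, sqrt (snd P - (norm (fst P))\<^sup>2)) \<in> hyp_space"
    by (auto simp: para_def hyp_space_def prod_eq_iff)
  then show "P \<in> para ` hyp_space" by blast
qed (auto simp: para_def hyp_space_def)

lemma convex_para_image_hyp_space: "convex (para ` hyp_space)"
  unfolding para_image_hyp_space
proof (rule convexI, safe)
  fix a b c d u v
  assume *: "(norm (fst (a::complex, b::real)))\<^sup>2 < snd (a, b)" "(norm (fst (c::complex, d::real)))\<^sup>2 < snd (c, d)"
    "0 \<le> (u::real)" "0 \<le> v" "u + v = 1"
  have "(norm (u *\<^sub>R a + v *\<^sub>R c))\<^sup>2
      = u * (norm a)\<^sup>2 + v * (norm c)\<^sup>2 - v * u * (norm (a - c))\<^sup>2"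
  proof -
    have "u = 1 - v" using * by simp
    then show ?thesis using norm_convex_combination_sq[of v a c] by simp
  qed
  also have "\<dots> \<le> u * (norm a)\<^sup>2 + v * (norm c)\<^sup>2" using * by simp
  also have "\<dots> < u * b + v * d"
  proof (cases "u = 0")
    case False
    then have "u * (norm a)\<^sup>2 < u * b" "v * (norm c)\<^sup>2 \<le> v * d"
      using * by (auto intro!: mult_left_mono)
    then show ?thesis by simp
  qed (use * in auto)
  finally show "(norm (fst (u *\<^sub>R (a, b) + v *\<^sub>R (c, d))))\<^sup>2 < snd (u *\<^sub>R (a, b) + v *\<^sub>R (c, d))"
    by simp
qed

lemma convex_para_image:
  assumes "hyp_convex S"
  shows "convex (para ` S)"
proof (rule convexI)
  fix P Q :: "complex \<times> real" and u v :: real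
  assume P: "P \<in> para ` S" and Q: "Q \<in> para ` S" and uv: "0 \<le> u" "0 \<le> v" "u + v = 1"
  obtain p q where pq: "p \<in> S" "q \<in> S" "P = para p" "Q = para q" using P Q by auto
  have H: "p \<in> hyp_space" "q \<in> hyp_space" using pq assms by (auto simp: hyp_convex_def)
  then have "u *\<^sub>R P + v *\<^sub>R Q \<in> para ` hyp_space"
    using convexD[OF convex_para_image_hyp_space] uv pq by auto
  then obtain r where r: "r \<in> hyp_space" "para r = u *\<^sub>R P + v *\<^sub>R Q" by auto
  have "r \<in> hyp_segment p q"
    by (rule hyp_segment_para[OF H r(1), of v]) (use uv r pq in \<open>auto simp: eq_diff_eq\<close>)
  then show "u *\<^sub>R P + v *\<^sub>R Q \<in> para ` S"
    using r assms pq unfolding hyp_convex_def by (metis imageI subsetD)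
qed

section \<open>Explicit geodesics and their ideal endpoints\<close>

lemma hyp_geodesicI:
  assumes "\<And>s. 0 < snd (g s)"
    and "\<And>s u. (dist (g s) (g u))\<^sup>2 = 2 * snd (g s) * snd (g u) * (cosh (s - u) - 1)"
  shows "hyp_geodesic g"
  unfolding hyp_geodesic_def
proof (intro conjI allI)
  show "range g \<subseteq> hyp_space" using assms(1) by (auto simp: hyp_space_def)
  fix s u
  have "1 + (dist (g s) (g u))\<^sup>2 / (2 * snd (g s) * snd (g u)) = cosh \<bar>s - u\<bar>"
    unfolding assms(2) using assms(1)[of s] assms(1)[of u] by (simp add: abs_if)
  then show "hyp_dist (g s) (g u) = \<bar>s - u\<bar>"
    by (simp add: hyp_dist_def arcosh_cosh_real del: cosh_real_abs)
qed

lemma hyp_geodesic_vertical: "hyp_geodesic (\<lambda>u. (x, exp u))"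
proof (rule hyp_geodesicI)
  fix s u :: real
  have "exp s * exp u * exp (s - u) = (exp s)\<^sup>2" "exp s * exp u * exp (u - s) = (exp u)\<^sup>2"
    by (simp_all add: exp_add[symmetric] exp_double[symmetric])
  then show "(dist (x, exp s) (x, exp u))\<^sup>2 = 2 * snd (x, exp s) * snd (x, exp u) * (cosh (s - u) - 1)"
    by (simp add: dist_prod_sq cosh_def power2_diff algebra_simps)
qed simp

lemma tends_to_ideal_vertical:
  "tends_to_ideal (\<lambda>u. (x, exp u)) (Some x) at_bot"
  "tends_to_ideal (\<lambda>u. (x, exp u)) None at_top"
proof -
  show "tends_to_ideal (\<lambda>u. (x, exp u)) (Some x) at_bot"
    unfolding tends_to_ideal_def by (auto intro!: tendsto_Pair exp_at_bot)
  have "filterlim (\<lambda>u. norm (x, exp u :: real)) at_top at_top"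
  proof (rule filterlim_at_top_mono[OF exp_at_top])
    show "\<forall>\<^sub>F u in at_top. exp u \<le> norm (x, exp u :: real)"
      by (intro always_eventually allI) (metis abs_exp_cancel real_norm_def norm_snd_le)
  qed
  then show "tends_to_ideal (\<lambda>u. (x, exp u)) None at_top"
    unfolding tends_to_ideal_def by (auto intro: filterlim_norm_at_top_imp_at_infinity)
qed

text \<open>The half-circle orthogonal to the boundary over the diameter from \<open>x\<close> to
  \<open>y\<close>, in arc-length parameter: \<open>(tanh u, 1 / cosh u)\<close> runs along the unit
  half-circle with unit hyperbolic speed.\<close>

definition semicircle :: "complex \<Rightarrow> complex \<Rightarrow> real \<Rightarrow> complex \<times> real" where
  "semicircle x y u = ((1/2) *\<^sub>R (x + y) + (tanh u / 2) *\<^sub>R (y - x), norm (x - y) / (2 * cosh u))"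

lemma hyp_geodesic_semicircle:
  assumes "x \<noteq> y"
  shows "hyp_geodesic (semicircle x y)"
proof (rule hyp_geodesicI)
  show "0 < snd (semicircle x y s)" for s
    using assms by (simp add: semicircle_def)
  fix s u :: real
  define d where "d = norm (x - y)"
  have c: "cosh s \<noteq> 0" "cosh u \<noteq> 0" by (simp_all add: cosh_real_nonzero)
  have cs: "(cosh s)\<^sup>2 = (sinh s)\<^sup>2 + 1" "(cosh u)\<^sup>2 = (sinh u)\<^sup>2 + 1"
    by (simp_all add: cosh_square_eq)
  have f: "fst (semicircle x y s) - fst (semicircle x y u) = ((tanh s - tanh u) / 2) *\<^sub>R (y - x)"
    by (simp add: semicircle_def algebra_simps diff_divide_distrib)
  have "(dist (semicircle x y s) (semicircle x y u))\<^sup>2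
      = d\<^sup>2 / 4 * ((tanh s - tanh u)\<^sup>2 + (1 / cosh s - 1 / cosh u)\<^sup>2)"
  proof -
    have "(norm (fst (semicircle x y s) - fst (semicircle x y u)))\<^sup>2 = d\<^sup>2 / 4 * (tanh s - tanh u)\<^sup>2"
      unfolding f by (simp add: d_def norm_minus_commute power_mult_distrib power_divide)
    moreover have "snd (semicircle x y s) - snd (semicircle x y u) = d / 2 * (1 / cosh s - 1 / cosh u)"
      by (simp add: semicircle_def d_def algebra_simps)
    ultimately show ?thesis
      unfolding dist_prod_sq by (simp only: power_mult_distrib power_divide) (simp add: algebra_simps)
  qed
  also have "(tanh s - tanh u)\<^sup>2 + (1 / cosh s - 1 / cosh u)\<^sup>2
      = 2 * (cosh s * cosh u - sinh s * sinh u - 1) / (cosh s * cosh u)"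
  proof -
    have "((sinh s * cosh u - sinh u * cosh s)\<^sup>2 + (cosh u - cosh s)\<^sup>2)
      = 2 * (cosh s * cosh u - sinh s * sinh u - 1) * (cosh s * cosh u)"
      using cs by algebra
    then show ?thesis using c unfolding tanh_def
      by (simp add: divide_simps power2_eq_square)
  qed
  also have "cosh s * cosh u - sinh s * sinh u = cosh (s - u)" by (simp add: cosh_diff)
  finally show "(dist (semicircle x y s) (semicircle x y u))\<^sup>2
    = 2 * snd (semicircle x y s) * snd (semicircle x y u) * (cosh (s - u) - 1)"
    using c by (simp add: semicircle_def d_def[symmetric] power2_eq_square field_simps)
qed

lemma tends_to_ideal_semicircle:
  "tends_to_ideal (semicircle x y) (Some x) at_bot"
  "tends_to_ideal (semicircle x y) (Some y) at_top"
proof -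
  have c: "((\<lambda>u. norm (x - y) / (2 * cosh u)) \<longlongrightarrow> 0) F"
    if "filterlim (cosh :: real \<Rightarrow> real) at_top F" for F
    by (intro real_tendsto_divide_at_top[OF tendsto_const]
        filterlim_tendsto_pos_mult_at_top[OF tendsto_const] that) simp
  have "((\<lambda>u. (1/2) *\<^sub>R (x + y) + (tanh u / 2) *\<^sub>R (y - x)) \<longlongrightarrow> (1/2) *\<^sub>R (x + y) + (-1 / 2) *\<^sub>R (y - x)) at_bot"
    by (intro tendsto_intros tanh_real_at_bot) simp
  also have "(1/2) *\<^sub>R (x + y) + (-1 / 2) *\<^sub>R (y - x) = x"
    by (simp add: scaleR_conv_of_real field_simps)
  finally show "tends_to_ideal (semicircle x y) (Some x) at_bot"
    unfolding tends_to_ideal_def semicircle_def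
    by (auto intro!: tendsto_Pair c cosh_real_at_bot)
  have "((\<lambda>u. (1/2) *\<^sub>R (x + y) + (tanh u / 2) *\<^sub>R (y - x)) \<longlongrightarrow> (1/2) *\<^sub>R (x + y) + (1 / 2) *\<^sub>R (y - x)) at_top"
    by (intro tendsto_intros tanh_real_at_top) simp
  also have "(1/2) *\<^sub>R (x + y) + (1 / 2) *\<^sub>R (y - x) = y"
    by (simp add: scaleR_conv_of_real field_simps)
  finally show "tends_to_ideal (semicircle x y) (Some y) at_top"
    unfolding tends_to_ideal_def semicircle_def
    by (auto intro!: tendsto_Pair c cosh_real_at_top)
qed

section \<open>The hull in the paraboloid picture\<close>

lemma hyp_convex_CH: "hyp_convex (CH E)"
proof -
  define S where "S = \<Union> {range g | g. hyp_geodesic g \<and>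
            (\<exists>x\<in>E. \<exists>y\<in>E. tends_to_ideal g x at_bot \<and> tends_to_ideal g y at_top)}"
  have CH: "CH E = hyp_convex hull S" by (simp add: CH_def S_def)
  \<comment> \<open>This makes \<open>hyp_space\<close> one of the sets intersected by
    \<open>hull\<close>; an empty family would give the whole type.\<close>
  have "S \<subseteq> hyp_space" by (auto simp: S_def hyp_geodesic_def)
  moreover have "hyp_convex hyp_space" by (auto simp: hyp_convex_def hyp_segment_def)
  ultimately have "CH E \<subseteq> hyp_space" unfolding CH by (rule hull_minimal)
  then show ?thesis
    unfolding CH hyp_convex_def hull_def by blast
qed

lemma CH_subset_hyp_space: "CH E \<subseteq> hyp_space"
  using hyp_convex_CH by (auto simp: hyp_convex_def)

lemma geodesic_in_CH:
  assumes "hyp_geodesic g" "x \<in> E" "y \<in> E" "tends_to_ideal g x at_bot" "tends_to_ideal g y at_top"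
  shows "g u \<in> CH E"
  unfolding CH_def by (rule hull_inc) (use assms in blast)

text \<open>Along the semicircle both coordinates of \<open>para\<close> are affine in
  \<open>tanh u\<close>, which runs through the open interval from -1 to 1, so the image is the
  chord without its ideal endpoints.\<close>

lemma open_segment_lift_in_para_CH:
  assumes "Some x \<in> E" "Some y \<in> E" "x \<noteq> y" "0 < a" "a < 1"
  shows "(1 - a) *\<^sub>R (x, (norm x)\<^sup>2) + a *\<^sub>R (y, (norm y)\<^sup>2) \<in> para ` CH E"
proof -
  have in_CH: "semicircle x y u \<in> CH E" for u
    by (rule geodesic_in_CH[OF hyp_geodesic_semicircle[OF assms(3)] assms(1,2) tends_to_ideal_semicircle])
  \<comment> \<open>The solution of \<open>tanh u = 2 * a - 1\<close>.\<close>
  define u where "u = ln (a / (1 - a)) / 2"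
  have "exp (- 2 * u) = (1 - a) / a"
    using assms by (simp add: u_def exp_minus)
  then have t: "tanh u = 2 * a - 1"
    unfolding tanh_real_altdef \<open>exp (- 2 * u) = (1 - a) / a\<close> using assms by (simp add: field_simps)
  have f: "fst (semicircle x y u) = (1 - a) *\<^sub>R x + a *\<^sub>R y"
    unfolding semicircle_def t by (simp add: scaleR_conv_of_real field_simps)
  have "1 - (tanh u)\<^sup>2 = 1 / (cosh u)\<^sup>2"
    by (simp add: tanh_def power_divide sinh_square_eq diff_divide_distrib)
  then have c: "1 / (cosh u)\<^sup>2 = 4 * a * (1 - a)" unfolding t
    by (simp add: power2_eq_square algebra_simps)
  have "(snd (semicircle x y u))\<^sup>2 = (norm (x - y))\<^sup>2 / 4 * (1 / (cosh u)\<^sup>2)"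
    by (simp add: semicircle_def power_divide power_mult_distrib)
  then have "snd (para (semicircle x y u)) = (1 - a) * (norm x)\<^sup>2 + a * (norm y)\<^sup>2"
    unfolding para_def c snd_conv f power2_norm_eq_inner
    by (simp add: inner_add_left inner_add_right inner_diff_left inner_diff_right inner_commute
        algebra_simps power2_eq_square)
  then have "para (semicircle x y u) = (1 - a) *\<^sub>R (x, (norm x)\<^sup>2) + a *\<^sub>R (y, (norm y)\<^sup>2)"
    using f by (simp add: prod_eq_iff) (simp add: para_def)
  then show ?thesis using in_CH[of u] by (metis imageI)
qed

subsection \<open>The hull of a set not contained in a circle has interior points\<close>

lemma orthogonal_complex_eq:
  fixes c w :: complex
  assumes "c \<noteq> 0" "c \<bullet> w = 0"
  shows "w = of_real (Im (cnj c * w) / (norm c)\<^sup>2) * (\<i> * c)"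
proof -
  have "Re (cnj c * w) = 0" using assms by (simp add: inner_complex_def)
  then have "cnj c * w = \<i> * of_real (Im (cnj c * w))" by (simp add: complex_eq_iff)
  then have "(c * cnj c) * w = c * (\<i> * of_real (Im (cnj c * w)))"
    by (metis mult.assoc)
  then show ?thesis
    using assms unfolding complex_norm_square[symmetric] by (simp add: field_simps)
qed

text \<open>The lift of \<open>x\<close> is an ideal point outside the image, so the equation is
  read off from two inner points of a chord ending there; this is where \<open>y\<close>
  enters.\<close>

lemma lift_on_hyperplane:
  assumes sub: "para ` CH E \<subseteq> {P. (c, d) \<bullet> P = b}"
    and "Some x \<in> E" "Some y \<in> E" "x \<noteq> y"
  shows "c \<bullet> x + d * (norm x)\<^sup>2 = b"
proof -
  have "(c, d) \<bullet> ((1 - a) *\<^sub>R (x, (norm x)\<^sup>2) + a *\<^sub>R (y, (norm y)\<^sup>2)) = b" if "0 < a" "a < 1" for a :: real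
    using open_segment_lift_in_para_CH[OF assms(2-4) that] sub by blast
  from this[of "1/3"] this[of "2/3"] show ?thesis
    by (simp add: inner_add_right algebra_simps)
qed

text \<open>The geodesic from \<open>x\<close> to infinity straightens to a vertical ray, and a
  hyperplane containing two of its points is vertical.\<close>

lemma vertical_on_hyperplane:
  assumes sub: "para ` CH E \<subseteq> {P. (c, d) \<bullet> P = b}"
    and "Some x \<in> E" "None \<in> E"
  shows "d = 0" "c \<bullet> x = b"
proof -
  have *: "c \<bullet> x + d * ((norm x)\<^sup>2 + (exp u)\<^sup>2) = b" for u :: real
  proof -
    have "(x, exp u) \<in> CH E"
      by (rule geodesic_in_CH[OF hyp_geodesic_vertical assms(2,3) tends_to_ideal_vertical])
    then have "(c, d) \<bullet> para (x, exp u) = b" using sub by blast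
    then show ?thesis by (simp add: para_def)
  qed
  from *[of 0] *[of "ln 2"] show "d = 0" by (simp add: algebra_simps)
  then show "c \<bullet> x = b" using *[of 0] by simp
qed

text \<open>A convex set without interior lies in a hyperplane, and the equation
  \<open>c \<bullet> z + d * (norm z)\<^sup>2 = b\<close> describes a line if \<open>d = 0\<close>
  and a circle otherwise. Sets with too few points to span a geodesic are put into a circle by
  hand.\<close>

lemma interior_para_CH_nonempty:
  assumes nc: "\<not> (\<exists>C. sphere_circle C \<and> E \<subseteq> C)"
  shows "interior (para ` CH E) \<noteq> {}"
proof
  assume "interior (para ` CH E) = {}"
  then obtain cd b where cd: "cd \<noteq> 0" "para ` CH E \<subseteq> {P. cd \<bullet> P = b}"
    using empty_interior_subset_hyperplane convex_para_image[OF hyp_convex_CH] by metis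
  obtain c d where [simp]: "cd = (c, d)" by (cases cd)
  have sub: "para ` CH E \<subseteq> {P. (c, d) \<bullet> P = b}" using cd by simp
  have in_line: "\<exists>C. sphere_circle C \<and> E \<subseteq> C"
    if "c \<noteq> 0" "\<And>x. Some x \<in> E \<Longrightarrow> c \<bullet> x = b" for c :: complex
  proof -
    \<comment> \<open>The foot of the perpendicular from the origin to the line.\<close>
    have "c \<bullet> ((b / (c \<bullet> c)) *\<^sub>R c) = b" using that(1) by simp
    then obtain x0 where x0: "c \<bullet> x0 = b" by blast
    have "x \<in> range (\<lambda>t::real. x0 + of_real t * (\<i> * c))" if "Some x \<in> E" for x
    proof -
      have "c \<bullet> (x - x0) = 0" using x0 \<open>\<And>x. Some x \<in> E \<Longrightarrow> c \<bullet> x = b\<close>[OF that]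
        by (simp add: inner_diff_right)
      from orthogonal_complex_eq[OF \<open>c \<noteq> 0\<close> this]
      obtain t :: real where "x - x0 = of_real t * (\<i> * c)" by blast
      then have "x = x0 + of_real t * (\<i> * c)" by (simp add: diff_eq_eq add.commute)
      then show ?thesis by blast
    qed
    then have "E \<subseteq> insert None (Some ` range (\<lambda>t::real. x0 + of_real t * (\<i> * c)))"
      by (intro subsetI) (case_tac x; auto)
    moreover have "\<i> * c \<noteq> 0" using that(1) by simp
    ultimately show ?thesis unfolding sphere_circle_def by blast
  qed
  show False
  proof (cases "None \<in> E")
    case True
    show False
    proof (cases "\<exists>x. Some x \<in> E")
      case True
      then have d: "d = 0" using vertical_on_hyperplane[OF sub] \<open>None \<in> E\<close> by blast
      then have "c \<noteq> 0" using cd by (auto simp: zero_prod_def)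
      then show False using in_line vertical_on_hyperplane[OF sub] \<open>None \<in> E\<close> nc by blast
    next
      case False
      then have "E \<subseteq> insert None (Some ` range (\<lambda>t::real. 0 + of_real t * 1))"
        using False by (intro subsetI) (case_tac x; auto)
      then show False using nc unfolding sphere_circle_def by (metis one_neq_zero)
    qed
  next
    case noinf: False
    show False
    proof (cases "\<exists>x y. Some x \<in> E \<and> Some y \<in> E \<and> x \<noteq> y")
      case True
      then obtain x y where xy: "Some x \<in> E" "Some y \<in> E" "x \<noteq> y" by blast
      have eq: "c \<bullet> z + d * (norm z)\<^sup>2 = b" if "Some z \<in> E" for z
        using lift_on_hyperplane[OF sub that] xy by metis
      show False
      proof (cases "d = 0")
        case True
        then have "c \<noteq> 0" using cd by (auto simp: zero_prod_def)
        then show False using in_line[of c] eq True nc by auto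
      next
        case False
        \<comment> \<open>Completing the square: \<open>z0\<close> is the centre and
          \<open>R\<close> the squared radius.\<close>
        define z0 where "z0 = (- 1 / (2 * d)) *\<^sub>R c"
        define R where "R = b / d + (norm z0)\<^sup>2"
        have R: "(dist z0 z)\<^sup>2 = R" if "Some z \<in> E" for z
        proof -
          have "(dist z0 z)\<^sup>2 = (norm z0)\<^sup>2 + (norm z)\<^sup>2 - 2 * (z0 \<bullet> z)"
            by (simp add: dist_norm power2_norm_eq_inner inner_diff_left inner_diff_right inner_commute)
          also have "\<dots> = R"
            unfolding R_def z0_def eq[OF that, symmetric] using False by (simp add: field_simps)
          finally show ?thesis .
        qed
        \<comment> \<open>Otherwise every finite point of \<open>E\<close> would equal
          \<open>z0\<close>, against the two distinct points \<open>x\<close> and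
          \<open>y\<close>.\<close>
        have "0 < R"
        proof (rule ccontr)
          assume "\<not> 0 < R"
          then have "dist z0 z = 0" if "Some z \<in> E" for z
            using R[OF that] zero_le_power2[of "dist z0 z"] by (simp add: not_less)
          from this[OF xy(1)] this[OF xy(2)] show False using xy(3) by simp
        qed
        moreover have "E \<subseteq> Some ` sphere z0 (sqrt R)"
        proof
          fix x assume "x \<in> E"
          then obtain z where z: "x = Some z" "Some z \<in> E" using noinf by (cases x) auto
          then have "dist z0 z = sqrt R" using R by (metis real_sqrt_unique zero_le_dist)
          then show "x \<in> Some ` sphere z0 (sqrt R)" using z by simp
        qed
        ultimately show False using nc unfolding sphere_circle_def by (metis real_sqrt_gt_zero)
      qed
    next
      case False
      have "\<exists>x. E \<subseteq> {Some x}"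
      proof (cases "E = {}")
        case nonempty: False
        then obtain u where "u \<in> E" by blast
        then obtain x where "Some x \<in> E" using noinf by (cases u) auto
        then have "E \<subseteq> {Some x}"
          using False noinf by (intro subsetI) (case_tac xa; auto)
        then show ?thesis by blast
      qed simp
      then obtain x where "E \<subseteq> {Some x}" by blast
      \<comment> \<open>Any circle through the single point will do.\<close>
      then have "E \<subseteq> Some ` sphere (x - 1) 1" by (auto simp: dist_norm)
      then show False using nc unfolding sphere_circle_def by (metis zero_less_one)
    qed
  qed
qed

subsection \<open>Inversion in the unit sphere\<close>

definition inversion :: "complex \<times> real \<Rightarrow> complex \<times> real" where
  "inversion p = (1 / (norm p)\<^sup>2) *\<^sub>R p"

definition ideal_inversion :: "riemann_sphere \<Rightarrow> riemann_sphere" where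
  "ideal_inversion x = (case x of
       None \<Rightarrow> Some 0
     | Some a \<Rightarrow> if a = 0 then None else Some ((1 / (norm a)\<^sup>2) *\<^sub>R a))"

lemma ideal_inversion_ideal_inversion [simp]: "ideal_inversion (ideal_inversion x) = x"
  by (auto simp: ideal_inversion_def power2_eq_square split: option.split)

lemma inversion_inversion [simp]: "inversion (inversion p) = p"
  by (cases "p = 0") (auto simp: inversion_def power2_eq_square)

lemma hyp_space_nonzero: "p \<in> hyp_space \<Longrightarrow> p \<noteq> 0"
  by (auto simp: hyp_space_def)

lemma inversion_in_hyp_space: "p \<in> hyp_space \<Longrightarrow> inversion p \<in> hyp_space"
  using hyp_space_nonzero[of p] by (simp add: inversion_def hyp_space_def)

lemma dist_inversion_sq:
  assumes "p \<noteq> 0" "q \<noteq> 0"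
  shows "(dist (inversion p) (inversion q))\<^sup>2 = (dist p q)\<^sup>2 / ((norm p)\<^sup>2 * (norm q)\<^sup>2)"
proof -
  define a b where "a = (norm p)\<^sup>2" and "b = (norm q)\<^sup>2"
  have ab: "a \<noteq> 0" "b \<noteq> 0" "p \<bullet> p = a" "q \<bullet> q = b"
    using assms by (auto simp: a_def b_def power2_norm_eq_inner)
  have "(dist (inversion p) (inversion q))\<^sup>2 = (p \<bullet> p) / (a * a) + (q \<bullet> q) / (b * b) - 2 * (p \<bullet> q) / (a * b)"
    unfolding inversion_def dist_norm power2_norm_eq_inner[of "_ - _"] a_def[symmetric] b_def[symmetric]
    by (simp add: inner_diff_left inner_diff_right inner_commute)
  also have "\<dots> = (p \<bullet> p + q \<bullet> q - 2 * (p \<bullet> q)) / (a * b)"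
    unfolding ab using ab by (simp add: field_simps)
  also have "p \<bullet> p + q \<bullet> q - 2 * (p \<bullet> q) = (dist p q)\<^sup>2"
    unfolding dist_norm power2_norm_eq_inner by (simp add: inner_diff_left inner_diff_right inner_commute)
  finally show ?thesis by (simp add: a_def b_def)
qed

lemma snd_inversion: "snd (inversion p) = snd p / (norm p)\<^sup>2"
  by (simp add: inversion_def)

lemma hyp_dist_inversion:
  assumes "p \<in> hyp_space" "q \<in> hyp_space"
  shows "hyp_dist (inversion p) (inversion q) = hyp_dist p q"
proof -
  have "p \<noteq> 0" "q \<noteq> 0" using assms by (auto simp: hyp_space_nonzero)
  then show ?thesis
    unfolding hyp_dist_def dist_inversion_sq[OF \<open>p \<noteq> 0\<close> \<open>q \<noteq> 0\<close>] snd_inversion by simp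
qed

lemma tends_to_ideal_inversion:
  assumes "\<And>u. g u \<in> hyp_space" "tends_to_ideal g x F"
  shows "tends_to_ideal (\<lambda>u. inversion (g u)) (ideal_inversion x) F"
proof -
  have nz: "g u \<noteq> 0" for u using assms(1) hyp_space_nonzero by blast
  have norm_inv: "norm (inversion p) = inverse (norm p)" for p
    by (simp add: inversion_def power2_eq_square field_simps)
  show ?thesis
  proof (cases x)
    case None
    then have "filterlim g at_infinity F" using assms by (simp add: tends_to_ideal_def)
    then have "((\<lambda>u. inverse (norm (g u))) \<longlongrightarrow> 0) F"
      by (intro tendsto_inverse_0_at_top filterlim_at_infinity_imp_norm_at_top)
    then have "((\<lambda>u. inversion (g u)) \<longlongrightarrow> 0) F"
      unfolding norm_inv[symmetric] by (rule tendsto_norm_zero_cancel)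
    then show ?thesis using None by (simp add: tends_to_ideal_def ideal_inversion_def zero_prod_def)
  next
    case (Some a)
    then have g: "(g \<longlongrightarrow> (a, 0)) F" using assms by (simp add: tends_to_ideal_def)
    show ?thesis
    proof (cases "a = 0")
      case True
      have "((\<lambda>u. norm (g u)) \<longlongrightarrow> 0) F"
        using tendsto_norm[OF g] True by (simp add: zero_prod_def[symmetric])
      then have "filterlim (\<lambda>u. norm (g u)) (at_right 0) F"
        using nz by (intro tendsto_imp_filterlim_at_right always_eventually) auto
      then have "filterlim (\<lambda>u. inverse (norm (g u))) at_top F"
        by (rule filterlim_compose[OF filterlim_inverse_at_top_right])
      then have "filterlim (\<lambda>u. inversion (g u)) at_infinity F"
        by (intro filterlim_norm_at_top_imp_at_infinity) (simp add: norm_inv)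
      then show ?thesis using Some True by (simp add: tends_to_ideal_def ideal_inversion_def)
    next
      case False
      have "((\<lambda>u. inversion (g u)) \<longlongrightarrow> (1 / (norm (a, 0::real))\<^sup>2) *\<^sub>R (a, 0)) F"
        unfolding inversion_def using False by (intro tendsto_intros g) (auto simp: zero_prod_def)
      then show ?thesis using Some False by (simp add: tends_to_ideal_def ideal_inversion_def)
    qed
  qed
qed

text \<open>The preimage \<open>T\<close> of the new hull is hyperbolically convex, because the
  inversion is an isometry, and contains the spanning geodesics, because it extends to their
  endpoints; minimality of the hull finishes. Since the inversion is an involution, this one
  inclusion serves both directions.\<close>

lemma inversion_in_CH:
  assumes "p \<in> CH E"
  shows "inversion p \<in> CH (ideal_inversion ` E)"
proof -
  define T where "T = {p \<in> hyp_space. inversion p \<in> CH (ideal_inversion ` E)}"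
  have "hyp_convex T"
    unfolding hyp_convex_def
  proof (intro conjI ballI subsetI)
    fix p q x assume pq: "p \<in> T" "q \<in> T" and x: "x \<in> hyp_segment p q"
    then have H: "p \<in> hyp_space" "q \<in> hyp_space" "x \<in> hyp_space"
      by (auto simp: T_def hyp_segment_def)
    then have "inversion x \<in> hyp_segment (inversion p) (inversion q)"
      using x by (simp add: hyp_segment_def hyp_dist_inversion inversion_in_hyp_space)
    then show "x \<in> T" using pq H hyp_convex_CH unfolding T_def hyp_convex_def by blast
  qed (simp add: T_def)
  moreover have "g u \<in> T" if g: "hyp_geodesic g" "x \<in> E" "y \<in> E"
    "tends_to_ideal g x at_bot" "tends_to_ideal g y at_top" for g x y u
  proof -
    have H: "g u \<in> hyp_space" for u using g(1) by (auto simp: hyp_geodesic_def)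
    have "hyp_geodesic (\<lambda>u. inversion (g u))"
      using g(1) H unfolding hyp_geodesic_def
      by (auto simp: inversion_in_hyp_space hyp_dist_inversion)
    then have "inversion (g u) \<in> CH (ideal_inversion ` E)"
      by (rule geodesic_in_CH[OF _ imageI[OF g(2)] imageI[OF g(3)]
        tends_to_ideal_inversion[OF H g(4)] tends_to_ideal_inversion[OF H g(5)]])
    then show ?thesis using H by (simp add: T_def)
  qed
  ultimately have "CH E \<subseteq> T"
    unfolding CH_def by (intro hull_minimal) blast+
  then show ?thesis using assms by (auto simp: T_def)
qed

section \<open>Interior points under \<open>para\<close> and under the inversion\<close>

lemma open_hyp_space: "open hyp_space"
  unfolding hyp_space_def by (intro open_Collect_less continuous_intros)

text \<open>\<open>para\<close> is a homeomorphism from \<open>hyp_space\<close> onto an open set.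
  The transfer is wanted because the circle argument lives above the paraboloid and the inversion in
  the half-space.\<close>

lemma interior_para_image_iff:
  assumes "K \<subseteq> hyp_space"
  shows "interior (para ` K) \<noteq> {} \<longleftrightarrow> interior K \<noteq> {}"
proof
  assume *: "interior (para ` K) \<noteq> {}"
  have "open (hyp_space \<inter> para -` interior (para ` K))"
    by (intro continuous_open_preimage open_hyp_space) (auto simp: para_def intro!: continuous_intros)
  moreover have "hyp_space \<inter> para -` interior (para ` K) \<subseteq> K"
    using inj_on_image_mem_iff[OF inj_on_para _ assms] interior_subset[of "para ` K"] by blast
  moreover have "hyp_space \<inter> para -` interior (para ` K) \<noteq> {}"
    using * assms interior_subset[of "para ` K"] by blast
  ultimately show "interior K \<noteq> {}" by (metis interior_maximal subset_empty)
next
  assume *: "interior K \<noteq> {}"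
  define f where "f P = (fst P, sqrt (snd P - (norm (fst P))\<^sup>2))" for P :: "complex \<times> real"
  have f: "f (para p) = p" if "p \<in> hyp_space" for p
    using that by (simp add: f_def para_def hyp_space_def)
  have op: "open (para ` hyp_space)"
    unfolding para_image_hyp_space by (intro open_Collect_less continuous_intros)
  have "open (para ` hyp_space \<inter> f -` interior K)"
    by (intro continuous_open_preimage op) (auto simp: f_def intro!: continuous_intros)
  moreover have "para ` hyp_space \<inter> f -` interior K \<subseteq> para ` K"
    using interior_subset[of K] by (auto simp: f)
  moreover have "para ` hyp_space \<inter> f -` interior K \<noteq> {}"
    using * interior_subset[of K] assms f by fastforce
  ultimately show "interior (para ` K) \<noteq> {}" by (metis interior_maximal subset_empty)
qed

lemma interior_CH_inversion:
  assumes "interior (CH E) \<noteq> {}"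
  shows "interior (CH (ideal_inversion ` E)) \<noteq> {}"
proof -
  have "open (hyp_space \<inter> inversion -` interior (CH E))"
    by (intro continuous_open_preimage open_hyp_space)
      (auto simp: inversion_def hyp_space_nonzero intro!: continuous_intros)
  moreover have "hyp_space \<inter> inversion -` interior (CH E) \<subseteq> CH (ideal_inversion ` E)"
    using interior_subset[of "CH E"] inversion_in_CH by (metis IntD2 inversion_inversion subsetD subsetI vimageD)
  moreover have "hyp_space \<inter> inversion -` interior (CH E) \<noteq> {}"
  proof -
    obtain p where p: "p \<in> interior (CH E)" using assms by blast
    then have "inversion p \<in> hyp_space"
      using interior_subset CH_subset_hyp_space inversion_in_hyp_space by blast
    then show ?thesis using p by (metis IntI emptyE inversion_inversion vimageI)
  qed
  ultimately show ?thesis by (metis interior_maximal subset_empty)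
qed

subsection \<open>Volume of hyperbolic balls\<close>

text \<open>As \<open>cosh d - 1\<close> is twice the square of \<open>sinh (d / 2)\<close>, for
  \<open>0 < r\<close> this is the hyperbolic ball of radius \<open>2 * arsinh (r / 2)\<close>. The
  condition is polynomial in coordinates, yet depends on \<open>hyp_dist\<close> alone, so
  isometries carry balls to balls.\<close>

definition hball :: "complex \<times> real \<Rightarrow> real \<Rightarrow> (complex \<times> real) set" where
  "hball p r = {q \<in> hyp_space. cosh (hyp_dist p q) < 1 + r\<^sup>2 / 2}"

lemma in_hball_iff:
  assumes "p \<in> hyp_space"
  shows "q \<in> hball p r \<longleftrightarrow> q \<in> hyp_space \<and> (dist p q)\<^sup>2 < r\<^sup>2 * snd p * snd q"
proof (cases "q \<in> hyp_space")
  case True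
  then have "0 < snd p" "0 < snd q" using assms by (auto simp: hyp_space_def)
  then show ?thesis using True
    by (simp add: hball_def hyp_dist_cosh[OF assms True] divide_less_eq) (simp add: algebra_simps)
qed (simp add: hball_def)

lemma open_hball:
  assumes "p \<in> hyp_space"
  shows "open (hball p r)"
proof -
  have "hball p r = {q. 0 < snd q} \<inter> {q. (dist p q)\<^sup>2 < r\<^sup>2 * snd p * snd q}"
    using in_hball_iff[OF assms] by (auto simp: hyp_space_def)
  then show ?thesis
    by (auto intro!: open_Int open_Collect_less continuous_intros)
qed

lemma hball_subset_ball:
  assumes "p \<in> hyp_space" "0 < r" "r \<le> 1"
  shows "hball p r \<subseteq> ball p (2 * r * snd p)"
proof
  fix q assume "q \<in> hball p r"
  then have q: "(dist p q)\<^sup>2 < r\<^sup>2 * snd p * snd q" "0 < snd q" "0 < snd p"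
    using assms by (auto simp: in_hball_iff hyp_space_def)
  have "snd q \<le> snd p + dist p q"
    using dist_snd_le[of q p] by (auto simp: dist_real_def dist_commute)
  then have "r\<^sup>2 * snd p * snd q \<le> r\<^sup>2 * snd p * (snd p + dist p q)"
    using q by (intro mult_left_mono) auto
  then have *: "(dist p q)\<^sup>2 < (r * snd p)\<^sup>2 + r * (r * snd p) * dist p q"
    using q(1) by (simp add: power2_eq_square algebra_simps)
  show "q \<in> ball p (2 * r * snd p)"
  proof (rule ccontr)
    assume "\<not> ?thesis"
    \<comment> \<open>Now the right side of \<open>*\<close> is at most a quarter plus a half of the
      squared distance; the factor 2 in the radius is chosen for this.\<close>
    then have d: "r * snd p \<le> dist p q / 2" by simp
    then have "(r * snd p)\<^sup>2 \<le> (dist p q / 2)\<^sup>2" using assms q by (intro power_mono) auto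
    moreover have "r * (r * snd p) \<le> 1 * (dist p q / 2)"
      using d assms q by (intro mult_mono) auto
    then have "r * (r * snd p) * dist p q \<le> 1 * (dist p q / 2) * dist p q"
      by (rule mult_right_mono) simp
    ultimately show False using * by (simp add: power2_eq_square) (smt (verit) zero_le_square)
  qed
qed

lemma ball_subset_hball:
  assumes "p \<in> hyp_space" "0 < r" "r \<le> 1" "q \<in> ball p (r * snd p / 2)"
  shows "q \<in> hball p r" "snd q \<le> 3 / 2 * snd p"
proof -
  have p: "0 < snd p" using assms by (simp add: hyp_space_def)
  have d: "dist p q < r * snd p / 2" using assms by simp
  have "r * snd p \<le> snd p" using p assms by simp
  moreover have "\<bar>snd p - snd q\<bar> \<le> dist p q"
    using dist_snd_le[of p q] by (simp add: dist_real_def)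
  ultimately have q: "snd p / 2 \<le> snd q" "snd q \<le> 3 / 2 * snd p"
    using d by auto
  have "(dist p q)\<^sup>2 < (r * snd p / 2)\<^sup>2" using d by (intro power_strict_mono) auto
  also have "\<dots> \<le> r\<^sup>2 * snd p * (snd p / 2)"
    using p assms by (simp add: power2_eq_square)
  also have "\<dots> \<le> r\<^sup>2 * snd p * snd q" using q p by (intro mult_left_mono) auto
  finally have "(dist p q)\<^sup>2 < r\<^sup>2 * snd p * snd q" .
  moreover have "0 < snd q" using p q by simp
  ultimately show "q \<in> hball p r" using assms by (simp add: in_hball_iff hyp_space_def)
  show "snd q \<le> 3 / 2 * snd p" by fact
qed

lemma hyp_volume_hball_ge:
  obtains v where "0 < v"
    "\<And>p r. p \<in> hyp_space \<Longrightarrow> 0 < r \<Longrightarrow> r \<le> 1 \<Longrightarrow> ennreal (v * r ^ 3) \<le> hyp_volume (hball p r)"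
proof
  \<comment> \<open>The Euclidean ball of radius \<open>r * snd p / 2\<close> stays below height
    \<open>3 / 2 * snd p\<close>, so the density there is at least
    \<open>8 / (27 * snd p ^ 3)\<close>. The powers of \<open>snd p\<close> cancel, and so does 8
    against the halved radius.\<close>
  define v where "v = unit_ball_vol (real DIM(complex \<times> real)) / 27"
  show "0 < v" by (simp add: v_def)
  fix p :: "complex \<times> real" and r :: real
  assume A: "p \<in> hyp_space" "0 < r" "r \<le> 1"
  then have p: "0 < snd p" by (simp add: hyp_space_def)
  let ?B = "ball p (r * snd p / 2)"
  have "ennreal (v * r ^ 3) = ennreal (8 / (27 * snd p ^ 3)) * emeasure lborel ?B"
    using A p by (subst emeasure_ball)
      (auto simp: v_def ennreal_mult[symmetric] power_divide power_mult_distrib)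
  also have "\<dots> = (\<integral>\<^sup>+q. ennreal (8 / (27 * snd p ^ 3)) * indicator ?B q \<partial>lborel)"
    by (subst nn_integral_cmult_indicator) auto
  also have "\<dots> \<le> hyp_volume (hball p r)"
    unfolding hyp_volume_def
  proof (rule nn_integral_mono)
    fix q :: "complex \<times> real"
    show "ennreal (8 / (27 * snd p ^ 3)) * indicator ?B q
        \<le> ennreal (1 / snd q ^ 3) * indicator (hball p r \<inter> hyp_space) q"
    proof (cases "q \<in> ?B")
      case True
      note B = ball_subset_hball[OF A True]
      then have H: "q \<in> hyp_space" by (simp add: hball_def)
      then have "0 < snd q" by (simp add: hyp_space_def)
      then have "snd q ^ 3 \<le> (3 / 2 * snd p) ^ 3" using B(2) by (intro power_mono) auto
      then have "8 / (27 * snd p ^ 3) \<le> 1 / snd q ^ 3"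
        using \<open>0 < snd q\<close> p by (simp add: field_simps power_mult_distrib power_divide)
      then show ?thesis using True B H by (simp add: ennreal_leI)
    qed simp
  qed
  finally show "ennreal (v * r ^ 3) \<le> hyp_volume (hball p r)" .
qed

lemma hyp_volume_mono: "A \<subseteq> B \<Longrightarrow> hyp_volume A \<le> hyp_volume B"
  unfolding hyp_volume_def by (intro nn_integral_mono) (auto simp: indicator_def)

text \<open>Double counting. Measurability comes from the openness of the pieces; the ambient set
  \<open>A\<close>, later a preimage of the hull, enters by monotonicity.\<close>

lemma sum_hyp_volume_le:
  assumes "finite I" "\<And>i. i \<in> I \<Longrightarrow> open (U i)" "\<And>i. i \<in> I \<Longrightarrow> U i \<subseteq> A"
    and M: "\<And>q. q \<in> hyp_space \<Longrightarrow> card {i \<in> I. q \<in> U i} \<le> M"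
  shows "(\<Sum>i\<in>I. hyp_volume (U i)) \<le> of_nat M * hyp_volume A"
proof -
  let ?f = "\<lambda>q :: complex \<times> real. ennreal (1 / snd q ^ 3)"
  let ?W = "(\<Union>i\<in>I. U i) \<inter> hyp_space"
  have [measurable]: "(snd :: complex \<times> real \<Rightarrow> real) \<in> borel_measurable borel"
    by (intro borel_measurable_continuous_onI continuous_intros)
  have [measurable]: "hyp_space \<in> sets borel"
    by (intro borel_open open_hyp_space)
  have U [measurable]: "U i \<in> sets borel" if "i \<in> I" for i
    using assms(2)[OF that] by (rule borel_open)
  have [measurable]: "(\<Union>i\<in>I. U i) \<in> sets borel"
    using assms by (intro borel_open open_UN) auto
  have "(\<Sum>i\<in>I. hyp_volume (U i))
      = (\<integral>\<^sup>+q. (\<Sum>i\<in>I. ?f q * indicator (U i \<inter> hyp_space) q) \<partial>lborel)"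
    unfolding hyp_volume_def by (subst nn_integral_sum) auto
  also have "\<dots> \<le> (\<integral>\<^sup>+q. of_nat M * (?f q * indicator ?W q) \<partial>lborel)"
  proof (rule nn_integral_mono)
    fix q :: "complex \<times> real"
    show "(\<Sum>i\<in>I. ?f q * indicator (U i \<inter> hyp_space) q) \<le> of_nat M * (?f q * indicator ?W q)"
    proof (cases "q \<in> ?W")
      case True
      have "(\<Sum>i\<in>I. indicator (U i \<inter> hyp_space) q :: ennreal) = (\<Sum>i\<in>{i \<in> I. q \<in> U i}. 1)"
        using True assms(1) by (intro sum.mono_neutral_cong_right) (auto simp: indicator_def)
      also have "\<dots> \<le> of_nat M" using M[of q] True by simp
      finally have "(\<Sum>i\<in>I. indicator (U i \<inter> hyp_space) q :: ennreal) \<le> of_nat M" .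
      then have "?f q * (\<Sum>i\<in>I. indicator (U i \<inter> hyp_space) q) \<le> ?f q * of_nat M"
        by (rule mult_left_mono) simp
      then show ?thesis using True unfolding sum_distrib_left by (simp add: mult.commute)
    qed (auto simp: indicator_def intro!: sum.neutral)
  qed
  also have "\<dots> = of_nat M * hyp_volume (\<Union>i\<in>I. U i)"
    unfolding hyp_volume_def by (subst nn_integral_cmult) auto
  also have "\<dots> \<le> of_nat M * hyp_volume A"
    using assms(3) by (intro mult_left_mono hyp_volume_mono) auto
  finally show ?thesis .
qed

subsection \<open>The hull near a pair of ideal points\<close>

text \<open>If \<open>K\<close> contains a fixed ball and the geodesic between \<open>x\<close> and \<open>y\<close>, then near height \<open>\<delta> = |x - y|\<close>
  it contains a Euclidean slab of size \<open>\<delta> \<times> \<delta> \<times> \<delta>\<^sup>2\<close>. In the paraboloid picture such a point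
  is \<open>(1 - \<delta>\<^sup>2) m' + \<delta>\<^sup>2 b\<close> with \<open>m'\<close> on the straightened geodesic and \<open>b\<close> in the ball; keeping the
  weight \<open>\<delta>\<^sup>2\<close> fixed turns the choice of \<open>b\<close> into an explicit estimate.\<close>

lemma slab_in_convex:
  fixes x y z0 e :: complex and w0 r0 \<eta> \<delta> :: real
  defines "\<delta> \<equiv> norm (x - y)" and "Z \<equiv> norm z0 + 1"
  defines "C \<equiv> 1 + (w0 - (norm z0)\<^sup>2) + Z\<^sup>2"
    and "e \<equiv> (1 / \<delta>) *\<^sub>R (y - x)"
    and "zs \<equiv> (1 - \<delta>\<^sup>2) *\<^sub>R ((1/2) *\<^sub>R (x + y)) + \<delta>\<^sup>2 *\<^sub>R z0"
  defines "ts \<equiv> sqrt ((1 - \<delta>\<^sup>2) * (((norm x)\<^sup>2 + (norm y)\<^sup>2) / 2) + \<delta>\<^sup>2 * w0 - (norm zs)\<^sup>2)"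
  assumes K: "K \<subseteq> hyp_space" "convex (para ` K)" "ball (z0, w0) r0 \<subseteq> para ` K"
    and seg: "\<And>a. 0 < a \<Longrightarrow> a < 1 \<Longrightarrow> (1 - a) *\<^sub>R (x, (norm x)\<^sup>2) + a *\<^sub>R (y, (norm y)\<^sup>2) \<in> para ` K"
    and xy: "norm x \<le> 1" "norm y \<le> 1" "0 < \<delta>" "\<delta> \<le> 1 / 2"
    and \<eta>: "0 < r0" "0 < \<eta>" "\<eta> \<le> 1 / 8" "\<eta> * (4 * Z + 3 * C + 2) < r0"
  shows "\<bar>a\<bar> \<le> \<eta> * \<delta> \<Longrightarrow> norm \<zeta> \<le> \<eta> * \<delta>\<^sup>2 \<Longrightarrow> \<bar>\<tau>\<bar> \<le> \<eta> * \<delta> \<Longrightarrow> (zs + a *\<^sub>R e + \<zeta>, ts + \<tau>) \<in> K"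
    and "\<delta> / 4 \<le> ts" "ts \<le> C * \<delta>" "norm (zs - x) \<le> (Z + 1) * \<delta>" "norm e = 1"
proof -
  define s m f0 where "s = \<delta>\<^sup>2" and "m = (1/2) *\<^sub>R (x + y)" and "f0 = w0 - (norm z0)\<^sup>2"
  have C: "C = 1 + f0 + Z\<^sup>2" by (simp add: C_def f0_def)
  have Z: "1 \<le> Z" "norm z0 \<le> Z" by (simp_all add: Z_def)
  have e_eq: "y - x = \<delta> *\<^sub>R e" using xy by (simp add: e_def)
  show e: "norm e = 1" using xy by (simp add: e_def \<delta>_def norm_minus_commute)
  have s: "0 < s" "s \<le> 1 / 4" "s \<le> \<delta>" "1 - s \<noteq> 0"
  proof -
    have *: "\<delta> * \<delta> \<le> 1 / 2 * \<delta>" using xy by (intro mult_right_mono) auto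
    show "0 < s" using xy by (simp add: s_def)
    show "s \<le> 1 / 4" "s \<le> \<delta>"
      unfolding s_def power2_eq_square using * xy by linarith+
    then show "1 - s \<noteq> 0" by linarith
  qed
  have zs: "zs = (1 - s) *\<^sub>R m + s *\<^sub>R z0" by (simp add: zs_def s_def m_def)
  have "(z0, w0) \<in> para ` hyp_space" using K \<eta> by (meson centre_in_ball image_mono subsetD)
  then have f0: "0 < f0" by (simp add: para_image_hyp_space f0_def)
  have "1 \<le> C" using f0 by (simp add: C)
  have m1: "norm m \<le> 1" using norm_triangle_ineq[of x y] xy by (simp add: m_def)
  have msq: "((norm x)\<^sup>2 + (norm y)\<^sup>2) / 2 = (norm m)\<^sup>2 + \<delta>\<^sup>2 / 4"
    unfolding m_def \<delta>_def power2_norm_eq_inner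
    by (simp add: inner_add_left inner_add_right inner_diff_left inner_diff_right inner_commute field_simps)
  \<comment> \<open>\<open>T\<close> is the gap between the mixed point and the paraboloid, hence
    the squared height of the slab centre; it lies between \<open>s / 16\<close> and
    \<open>s * C\<^sup>2\<close>.\<close>
  define T where "T = (1 - s) * (((norm x)\<^sup>2 + (norm y)\<^sup>2) / 2) + s * w0 - (norm zs)\<^sup>2"
  have "T = (1 - s) * \<delta>\<^sup>2 / 4 + s * f0 + s * (1 - s) * (norm (m - z0))\<^sup>2"
    unfolding T_def zs norm_convex_combination_sq msq f0_def by (simp add: algebra_simps)
  then have T: "T = s * ((1 - s) / 4 + f0 + (1 - s) * (norm (m - z0))\<^sup>2)"
    unfolding s_def[symmetric] by (simp add: algebra_simps)
  have mz: "norm (m - z0) \<le> Z" using norm_triangle_ineq4[of m z0] m1 by (simp add: Z_def)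
  have "s * (1 / 16) \<le> T"
    unfolding T using s f0 by (intro mult_left_mono add_increasing2) auto
  then have "(\<delta> / 4)\<^sup>2 \<le> T" by (simp add: s_def power_divide)
  then show ts_ge: "\<delta> / 4 \<le> ts" unfolding ts_def s_def[symmetric] T_def[symmetric]
    by (rule real_le_rsqrt)
  then have ts0: "0 < ts" and T0: "0 < T"
    using xy \<open>(\<delta> / 4)\<^sup>2 \<le> T\<close> by (auto intro: less_le_trans[rotated])
  have "ts = sqrt T" by (simp add: ts_def s_def T_def)
  then have ts_sq: "ts\<^sup>2 = T" using T0 by simp
  have "(1 - s) * (norm (m - z0))\<^sup>2 \<le> 1 * Z\<^sup>2"
    using s mz by (intro mult_mono power_mono) auto
  then have "(1 - s) / 4 + f0 + (1 - s) * (norm (m - z0))\<^sup>2 \<le> C"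
    unfolding C using s by (intro add_mono) auto
  also have "C \<le> C\<^sup>2" using \<open>1 \<le> C\<close> by (simp add: power2_eq_square)
  finally have "T \<le> s * C\<^sup>2" unfolding T using s by (intro mult_left_mono) auto
  then have "ts\<^sup>2 \<le> (C * \<delta>)\<^sup>2" by (simp add: ts_sq s_def power_mult_distrib mult.commute)
  then show ts_le: "ts \<le> C * \<delta>" by (rule power2_le_imp_le) (use \<open>1 \<le> C\<close> xy in simp)
  have zsm: "norm (zs - m) \<le> s * Z"
  proof -
    have "zs - m = s *\<^sub>R (z0 - m)" by (simp add: zs algebra_simps)
    then show ?thesis using s mz by (simp add: norm_minus_commute)
  qed
  have "norm (m - x) = \<delta> / 2"
  proof -
    have "m - x = (1/2) *\<^sub>R (y - x)" by (simp add: m_def scaleR_conv_of_real field_simps)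
    then show ?thesis by (simp add: \<delta>_def norm_minus_commute)
  qed
  then have "norm (zs - x) \<le> s * Z + \<delta> / 2"
    using norm_triangle_ineq[of "zs - m" "m - x"] zsm by simp
  also have "s * Z \<le> \<delta> * Z" using s Z by (intro mult_right_mono) auto
  finally show "norm (zs - x) \<le> (Z + 1) * \<delta>" using xy by (simp add: algebra_simps)
  have zsZ: "norm zs \<le> Z"
  proof -
    have "norm zs \<le> (1 - s) * norm m + s * norm z0"
      unfolding zs using s by (intro order_trans[OF norm_triangle_ineq]) auto
    also have "\<dots> \<le> (1 - s) * Z + s * Z"
      using s m1 Z by (intro add_mono mult_left_mono) auto
    finally show ?thesis by (simp add: algebra_simps)
  qed
  show "(zs + a *\<^sub>R e + \<zeta>, ts + \<tau>) \<in> K"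
    if a: "\<bar>a\<bar> \<le> \<eta> * \<delta>" and \<zeta>: "norm \<zeta> \<le> \<eta> * \<delta>\<^sup>2" and \<tau>: "\<bar>\<tau>\<bar> \<le> \<eta> * \<delta>"
  proof -
    \<comment> \<open>The displacement \<open>a\<close> is produced by sliding along the chord,
      \<zeta> by moving the point of the ball by \<open>\<zeta> / s\<close>, and the remaining
      vertical mismatch \<Delta> by moving it by \<open>\<Delta> / s\<close>. So \<Delta> must be of
      order \<open>\<eta> * s\<close>.\<close>
    define p \<alpha> where "p = (zs + a *\<^sub>R e + \<zeta>, ts + \<tau>)" and "\<alpha> = 1 / 2 + a / ((1 - s) * \<delta>)"
    have \<eta>\<delta>: "\<eta> * \<delta> \<le> \<delta> / 8" using \<eta> xy by simp
    have "0 < ts + \<tau>" using ts_ge \<tau> \<eta>\<delta> xy by linarith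
    then have H: "p \<in> hyp_space" by (simp add: hyp_space_def p_def)
    have "\<bar>a / ((1 - s) * \<delta>)\<bar> < 1 / 2"
    proof -
      have "\<bar>a\<bar> \<le> \<delta> / 8" using a \<eta>\<delta> by linarith
      moreover have "3 / 4 * \<delta> \<le> (1 - s) * \<delta>" using s xy by (intro mult_right_mono) auto
      ultimately have "\<bar>a\<bar> < (1 - s) * \<delta> / 2" using xy by linarith
      then show ?thesis using s xy by (simp add: abs_divide abs_mult field_simps)
    qed
    then have \<alpha>: "0 < \<alpha>" "\<alpha> < 1" unfolding \<alpha>_def abs_less_iff by linarith+
    define \<Delta> where "\<Delta> = snd (para p) - s * w0 - (1 - s) * ((1 - \<alpha>) * (norm x)\<^sup>2 + \<alpha> * (norm y)\<^sup>2)"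
    have sa: "(1 - s) * (\<alpha> - 1 / 2) * \<delta> = a" using s xy by (simp add: \<alpha>_def)
    have "(1 - s) * ((1 - \<alpha>) * (norm x)\<^sup>2 + \<alpha> * (norm y)\<^sup>2)
      = (1 - s) * (((norm x)\<^sup>2 + (norm y)\<^sup>2) / 2) + (1 - s) * (\<alpha> - 1 / 2) * ((norm y)\<^sup>2 - (norm x)\<^sup>2)"
      by (simp add: field_simps)
    also have "(norm y)\<^sup>2 - (norm x)\<^sup>2 = \<delta> * (2 * (m \<bullet> e))"
    proof -
      have "\<delta> * (2 * (m \<bullet> e)) = 2 * (m \<bullet> (y - x))" by (simp add: e_eq)
      also have "\<dots> = y \<bullet> y - x \<bullet> x"
        by (simp add: m_def inner_add_left inner_add_right inner_diff_left inner_diff_right inner_commute)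
      finally show ?thesis by (simp add: power2_norm_eq_inner)
    qed
    also have "(1 - s) * (\<alpha> - 1 / 2) * (\<delta> * (2 * (m \<bullet> e))) = 2 * a * (m \<bullet> e)"
      using sa by (metis (no_types, opaque_lifting) mult.assoc mult.left_commute)
    finally have w: "(1 - s) * ((1 - \<alpha>) * (norm x)\<^sup>2 + \<alpha> * (norm y)\<^sup>2)
      = T + (norm zs)\<^sup>2 - s * w0 + 2 * a * (m \<bullet> e)" by (simp add: T_def)
    have "\<Delta> = (norm (zs + (a *\<^sub>R e + \<zeta>)))\<^sup>2 + (ts + \<tau>)\<^sup>2 - T - (norm zs)\<^sup>2 - 2 * a * (m \<bullet> e)"
      unfolding \<Delta>_def w by (simp add: para_def p_def add.assoc)
    also have "(norm (zs + (a *\<^sub>R e + \<zeta>)))\<^sup>2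
      = (norm zs)\<^sup>2 + 2 * a * (zs \<bullet> e) + 2 * (zs \<bullet> \<zeta>) + (norm (a *\<^sub>R e + \<zeta>))\<^sup>2"
      unfolding power2_norm_eq_inner
      by (simp add: inner_add_left inner_add_right inner_commute algebra_simps)
    also have "(ts + \<tau>)\<^sup>2 = T + \<tau> * (2 * ts + \<tau>)"
      using ts_sq by (simp add: power2_eq_square algebra_simps)
    \<comment> \<open>The linear term \<open>2 * a * (m \<bullet> e)\<close> of the chord has been
      subtracted from that of the paraboloid, leaving the factor \<open>zs - m\<close> of order
      \<open>s\<close>. This permits displacements of size \<open>\<eta> * \<delta>\<close> along
      \<open>e\<close>, whereas \<zeta> is restricted to
      \<open>\<eta> * \<delta>\<^sup>2\<close>.\<close>
    finally have \<Delta>: "\<Delta> = 2 * (a * ((zs - m) \<bullet> e)) + 2 * (zs \<bullet> \<zeta>) + (norm (a *\<^sub>R e + \<zeta>))\<^sup>2 + \<tau> * (2 * ts + \<tau>)"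
      by (simp add: inner_diff_left algebra_simps)
    have "\<bar>a * ((zs - m) \<bullet> e)\<bar> \<le> \<eta> * 1 * (s * Z)"
    proof -
      have "\<bar>(zs - m) \<bullet> e\<bar> \<le> s * Z" using Cauchy_Schwarz_ineq2[of "zs - m" e] e zsm by simp
      moreover have "\<eta> * \<delta> \<le> \<eta> * 1" using \<eta> xy by (intro mult_left_mono) auto
      then have "\<bar>a\<bar> \<le> \<eta> * 1" using a by linarith
      ultimately show ?thesis unfolding abs_mult using \<eta> by (intro mult_mono) auto
    qed
    moreover have "\<bar>zs \<bullet> \<zeta>\<bar> \<le> Z * (\<eta> * s)"
      using Cauchy_Schwarz_ineq2[of zs \<zeta>] zsZ \<zeta> Z
      by (intro order_trans[OF Cauchy_Schwarz_ineq2] mult_mono) (auto simp: s_def)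
    moreover have "(norm (a *\<^sub>R e + \<zeta>))\<^sup>2 \<le> \<eta> * s"
    proof -
      have "\<eta> * \<delta>\<^sup>2 \<le> \<eta> * \<delta>" using s \<eta> by (intro mult_left_mono) (auto simp: s_def)
      then have "norm (a *\<^sub>R e + \<zeta>) \<le> 2 * (\<eta> * \<delta>)"
        using norm_triangle_ineq[of "a *\<^sub>R e" \<zeta>] a \<zeta> e by simp
      then have "(norm (a *\<^sub>R e + \<zeta>))\<^sup>2 \<le> (2 * (\<eta> * \<delta>))\<^sup>2" by (intro power_mono) auto
      also have "\<dots> = (4 * \<eta>) * (\<eta> * s)" by (simp add: s_def power2_eq_square)
      also have "\<dots> \<le> 1 * (\<eta> * s)" using \<eta> s by (intro mult_right_mono) auto
      finally show ?thesis by simp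
    qed
    moreover have "\<bar>\<tau> * (2 * ts + \<tau>)\<bar> \<le> \<eta> * \<delta> * (3 * C * \<delta>)"
    proof -
      have "\<delta> / 8 \<le> C * \<delta>" using \<open>1 \<le> C\<close> xy by (simp add: mult_le_cancel_right)
      then have "\<bar>2 * ts + \<tau>\<bar> \<le> 3 * C * \<delta>" using ts_le ts0 \<tau> \<eta>\<delta> by simp
      then show ?thesis unfolding abs_mult using \<tau> \<eta> xy by (intro mult_mono) auto
    qed
    moreover have "\<bar>2 * t1 + 2 * t2 + t3 + t4\<bar> \<le> 2 * u1 + 2 * u2 + u3 + u4"
      if "\<bar>t1\<bar> \<le> u1" "\<bar>t2\<bar> \<le> u2" "t3 \<le> u3" "\<bar>t4\<bar> \<le> u4" "0 \<le> t3" for t1 t2 t3 t4 u1 u2 u3 u4 :: real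
      using that by linarith
    ultimately have "\<bar>\<Delta>\<bar> \<le> 2 * (\<eta> * 1 * (s * Z)) + 2 * (Z * (\<eta> * s)) + \<eta> * s + \<eta> * \<delta> * (3 * C * \<delta>)"
      unfolding \<Delta> by (metis zero_le_power2)
    also have "\<dots> = s * (\<eta> * (4 * Z + 3 * C + 1))"
      by (simp add: s_def power2_eq_square algebra_simps)
    finally have "\<bar>\<Delta>\<bar> / s \<le> \<eta> * (4 * Z + 3 * C + 1)" using s by (simp add: field_simps)
    moreover have "norm \<zeta> / s \<le> \<eta>" using \<zeta> s by (simp add: s_def[symmetric] field_simps)
    \<comment> \<open>The constant assumed for \<eta> is the one bounding \<Delta> plus one more for
      \<zeta>.\<close>
    ultimately have "norm \<zeta> / s + \<bar>\<Delta>\<bar> / s < r0" using \<eta>(4) by (simp add: algebra_simps)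
    moreover define b where "b = (z0 + (1 / s) *\<^sub>R \<zeta>, w0 + \<Delta> / s)"
    have "dist (z0, w0) b \<le> norm \<zeta> / s + \<bar>\<Delta>\<bar> / s"
      using norm_Pair_le[of "- ((1 / s) *\<^sub>R \<zeta>)" "- (\<Delta> / s)"] s
      by (simp add: b_def dist_norm)
    ultimately have "b \<in> ball (z0, w0) r0" by simp
    then have "b \<in> para ` K" using K by blast
    from convexD[OF K(2) seg[OF \<alpha>] this, of "1 - s" s] s
    have "(1 - s) *\<^sub>R ((1 - \<alpha>) *\<^sub>R (x, (norm x)\<^sup>2) + \<alpha> *\<^sub>R (y, (norm y)\<^sup>2)) + s *\<^sub>R b \<in> para ` K"
      by simp
    moreover have "(1 - s) *\<^sub>R ((1 - \<alpha>) *\<^sub>R x + \<alpha> *\<^sub>R y) + s *\<^sub>R (z0 + (1 / s) *\<^sub>R \<zeta>) = fst p"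
    proof -
      have "(1 - \<alpha>) *\<^sub>R x + \<alpha> *\<^sub>R y = m + (\<alpha> - 1 / 2) *\<^sub>R (y - x)"
        by (simp add: m_def scaleR_conv_of_real field_simps)
      also have "(1 - s) *\<^sub>R \<dots> = (1 - s) *\<^sub>R m + a *\<^sub>R e"
        unfolding e_eq using sa by (simp add: scaleR_add_right)
      finally show ?thesis using s by (simp add: p_def zs scaleR_add_right)
    qed
    moreover have "(1 - s) * ((1 - \<alpha>) * (norm x)\<^sup>2 + \<alpha> * (norm y)\<^sup>2) + s * (w0 + \<Delta> / s) = snd (para p)"
      using s by (simp add: \<Delta>_def distrib_left)
    moreover have "fst (para p) = fst p" by (simp add: para_def)
    ultimately have "para p \<in> para ` K"
      by (simp add: b_def) (metis prod.collapse)
    then show ?thesis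
      using inj_on_image_mem_iff[OF inj_on_para H K(1)] by (simp add: p_def)
  qed
qed

lemma hball_isometry_iff:
  assumes "\<And>p. p \<in> hyp_space \<Longrightarrow> f p \<in> hyp_space"
    and "\<And>p. p \<in> hyp_space \<Longrightarrow> f (f p) = p"
    and "\<And>p q. p \<in> hyp_space \<Longrightarrow> q \<in> hyp_space \<Longrightarrow> hyp_dist (f p) (f q) = hyp_dist p q"
    and "p \<in> hyp_space"
  shows "q \<in> hball (f p) r \<longleftrightarrow> q \<in> hyp_space \<and> f q \<in> hball p r"
proof (cases "q \<in> hyp_space")
  case True
  then have "hyp_dist (f p) q = hyp_dist p (f q)"
    using assms(3)[OF assms(4) assms(1)[OF True]] assms(2)[OF True] by simp
  then show ?thesis using True assms(1) by (simp add: hball_def)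
qed (simp add: hball_def)

text \<open>The slab is filled with hyperbolic balls of radius comparable to \<open>\<delta>\<close>, about \<open>\<delta>\<^sup>-\<^sup>2\<close> of them. Balls can be
  transported by an isometric involution \<open>f\<close> (below: the identity or an inversion) without a change
  of variables in the volume integral.\<close>

lemma patch_volume:
  fixes f :: "complex \<times> real \<Rightarrow> complex \<times> real"
  assumes K: "K \<subseteq> hyp_space" "convex (para ` K)" "interior (para ` K) \<noteq> {}"
    and f: "\<And>p. p \<in> hyp_space \<Longrightarrow> f p \<in> hyp_space"
      "\<And>p. p \<in> hyp_space \<Longrightarrow> f (f p) = p"
      "\<And>p q. p \<in> hyp_space \<Longrightarrow> q \<in> hyp_space \<Longrightarrow> hyp_dist (f p) (f q) = hyp_dist p q"
  obtains \<kappa> C where "0 < \<kappa>" "1 \<le> C"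
    "\<And>x y. norm x \<le> 1 \<Longrightarrow> norm y \<le> 1 \<Longrightarrow> x \<noteq> y \<Longrightarrow> norm (x - y) \<le> 1 / 2 \<Longrightarrow>
      (\<And>a. 0 < a \<Longrightarrow> a < 1 \<Longrightarrow>
        (1 - a) *\<^sub>R (x, (norm x)\<^sup>2) + a *\<^sub>R (y, (norm y)\<^sup>2) \<in> para ` K) \<Longrightarrow>
      \<exists>U. open U \<and> U \<subseteq> {q \<in> hyp_space. f q \<in> K \<and> norm (fst (f q) - x) \<le> C * norm (x - y)
          \<and> norm (x - y) \<le> C * snd (f q) \<and> snd (f q) \<le> C * norm (x - y)}
        \<and> ennreal (\<kappa> * norm (x - y)) \<le> hyp_volume U"
proof -
  obtain P0 r0 where "0 < r0" "ball P0 r0 \<subseteq> para ` K"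
    using K(3) by (meson ex_in_conv mem_interior)
  moreover obtain z0 w0 where "P0 = (z0, w0)" by (cases P0)
  ultimately have B: "0 < r0" "ball (z0, w0) r0 \<subseteq> para ` K" by auto
  obtain v where v: "0 < v"
    "\<And>p r. p \<in> hyp_space \<Longrightarrow> 0 < r \<Longrightarrow> r \<le> 1 \<Longrightarrow> ennreal (v * r ^ 3) \<le> hyp_volume (hball p r)"
    using hyp_volume_hball_ge by blast
  define Z C where "Z = norm z0 + 1" and "C = 1 + (w0 - (norm z0)\<^sup>2) + Z\<^sup>2"
  have "(z0, w0) \<in> para ` hyp_space" using K B by (meson centre_in_ball image_mono subsetD)
  then have "(norm z0)\<^sup>2 < w0" by (simp add: para_image_hyp_space)
  then have ZC: "1 \<le> Z" "1 \<le> C"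
    unfolding C_def using zero_le_power2[of Z] by (simp add: Z_def, linarith)
  define D where "D = 4 * Z + 3 * C + 2"
  define \<eta> where "\<eta> = min (1 / 8) (r0 / (2 * D))"
  have D: "0 < D" using ZC by (simp add: D_def)
  have \<eta>: "0 < \<eta>" "\<eta> \<le> 1 / 8" "\<eta> * D < r0"
  proof -
    show "0 < \<eta>" "\<eta> \<le> 1 / 8" using B D by (auto simp: \<eta>_def)
    have "\<eta> * D \<le> r0 / (2 * D) * D" using D by (intro mult_right_mono) (auto simp: \<eta>_def)
    then show "\<eta> * D < r0" using D B by simp
  qed
  \<comment> \<open>Centres lie at height at most \<open>2 * C * \<delta>\<close>, so a ball with
    \<open>r = \<kappa> * \<delta>\<close> has Euclidean radius at most
    \<open>4 * C * \<kappa> * \<delta>\<^sup>2\<close>, which is half the grid spacing \<mu>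
    below.\<close>
  define \<kappa> where "\<kappa> = \<eta> / (16 * C)"
  have \<kappa>: "0 < \<kappa>" "\<kappa> \<le> 1" using \<eta> ZC by (auto simp: \<kappa>_def field_simps)
  show thesis
  proof
    show "0 < v * \<kappa> ^ 3" using v \<kappa> by simp
    \<comment> \<open>One constant dominating the three that occur: \<open>Z + 2\<close>
      horizontally, 8 below and \<open>C + 1\<close> above.\<close>
    show "1 \<le> Z + C + 8" using ZC by simp
    fix x y :: complex
    assume xy: "norm x \<le> 1" "norm y \<le> 1" "x \<noteq> y" "norm (x - y) \<le> 1 / 2"
      and seg: "\<And>a. 0 < a \<Longrightarrow> a < 1 \<Longrightarrow>
        (1 - a) *\<^sub>R (x, (norm x)\<^sup>2) + a *\<^sub>R (y, (norm y)\<^sup>2) \<in> para ` K"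
    define \<delta> where "\<delta> = norm (x - y)"
    have \<delta>: "0 < \<delta>" "\<delta> \<le> 1 / 2" using xy by (auto simp: \<delta>_def)
    obtain zs ts e where slab:
      "\<And>a \<zeta> \<tau>. \<bar>a\<bar> \<le> \<eta> * \<delta> \<Longrightarrow> norm \<zeta> \<le> \<eta> * \<delta>\<^sup>2 \<Longrightarrow> \<bar>\<tau>\<bar> \<le> \<eta> * \<delta> \<Longrightarrow>
        (zs + a *\<^sub>R e + \<zeta>, ts + \<tau>) \<in> K"
      "\<delta> / 4 \<le> ts" "ts \<le> C * \<delta>" "norm (zs - x) \<le> (Z + 1) * \<delta>" "norm e = 1"
      using slab_in_convex[OF K(1,2) B(2) seg xy(1,2), of \<eta>] \<delta> B(1) \<eta>
      unfolding \<delta>_def[symmetric] Z_def[symmetric] C_def[symmetric] D_def[symmetric]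
      by blast
    \<comment> \<open>The centres form a planar grid along \<open>e\<close> and the vertical. At
      most \<open>1 / \<delta>\<close> steps of length \<mu> use half of the admissible displacement
      \<open>\<eta> * \<delta>\<close>; the other half is room for the balls.\<close>
    define n \<mu> r where "n = nat \<lfloor>1 / \<delta>\<rfloor>" and "\<mu> = \<eta> * \<delta>\<^sup>2 / 2" and "r = \<kappa> * \<delta>"
    have \<mu>: "0 < \<mu>" using \<eta> \<delta> by (simp add: \<mu>_def)
    have r: "0 < r" "r \<le> 1" using \<kappa> \<delta> by (auto simp: r_def intro!: mult_le_one)
    have \<eta>\<delta>: "\<eta> * \<delta> \<le> \<delta> / 8" "\<mu> \<le> \<eta> * \<delta> / 2" "0 < \<eta> * \<delta>"
      using \<eta> \<delta> by (auto simp: \<mu>_def power2_eq_square)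
    have k: "0 \<le> real k * \<mu>" "real k * \<mu> \<le> \<eta> * \<delta> / 2" if "k \<le> n" for k
    proof -
      have "real k \<le> 1 / \<delta>" using that \<delta> unfolding n_def by (simp add: le_nat_iff le_floor_iff)
      then have "real k * \<mu> \<le> 1 / \<delta> * \<mu>" using \<mu> by (intro mult_right_mono) auto
      then show "real k * \<mu> \<le> \<eta> * \<delta> / 2" using \<delta> by (simp add: \<mu>_def power2_eq_square)
    qed (use \<mu> in simp)
    define p where "p = (\<lambda>(k, l). (zs + (real k * \<mu>) *\<^sub>R e, ts + real l * \<mu>))"
    define I where "I = {..n} \<times> {..n}"
    have pK: "p i \<in> K" if "i \<in> I" for i
    proof -
      obtain a b where i: "i = (a, b)" "a \<le> n" "b \<le> n" using \<open>i \<in> I\<close> by (auto simp: I_def)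
      show ?thesis using slab(1)[of "real a * \<mu>" 0 "real b * \<mu>"] k[OF i(2)] k[OF i(3)] \<eta>\<delta> \<eta>
        by (simp add: p_def i)
    qed
    then have pH: "p i \<in> hyp_space" if "i \<in> I" for i using that K by blast
    have close: "dist (p i) q < \<mu> / 2" if "i \<in> I" "q \<in> hball (p i) r" for i q
    proof -
      obtain a b where i: "i = (a, b)" "a \<le> n" "b \<le> n" using \<open>i \<in> I\<close> by (auto simp: I_def)
      have "\<delta> / 8 \<le> C * \<delta>" using ZC \<delta> by (simp add: mult_le_cancel_right)
      moreover have "snd (p i) = ts + real b * \<mu>" by (simp add: p_def i)
      ultimately have "snd (p i) \<le> 2 * C * \<delta>" using k[OF i(3)] slab(3) \<eta>\<delta> \<delta> by linarith
      then have "2 * r * snd (p i) \<le> 2 * r * (2 * C * \<delta>)" using r by (intro mult_left_mono) auto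
      also have "\<dots> = \<mu> / 2" using ZC by (simp add: r_def \<kappa>_def \<mu>_def power2_eq_square)
      finally show ?thesis using hball_subset_ball[OF pH r] that by fastforce
    qed
    have near: "q \<in> K \<and> norm (fst q - x) \<le> (Z + C + 8) * \<delta> \<and> \<delta> \<le> (Z + C + 8) * snd q
        \<and> snd q \<le> (Z + C + 8) * \<delta>" if i: "i \<in> I" and q: "q \<in> hball (p i) r" for i q
    proof -
      obtain a b where ab: "i = (a, b)" "a \<le> n" "b \<le> n" using i by (auto simp: I_def)
      define \<zeta> \<tau> where "\<zeta> = fst q - fst (p i)" and "\<tau> = snd q - snd (p i)"
      have b: "norm \<zeta> < \<mu> / 2" "\<bar>\<tau>\<bar> < \<mu> / 2"
        using close[OF i q] dist_fst_le[of q "p i"] dist_snd_le[of q "p i"]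
        unfolding \<zeta>_def \<tau>_def dist_commute[of q] dist_norm[of "fst q"] dist_norm[of "snd q"] real_norm_def
        by linarith+
      have q_eq: "q = (zs + (real a * \<mu>) *\<^sub>R e + \<zeta>, ts + (real b * \<mu> + \<tau>))"
        by (simp add: \<zeta>_def \<tau>_def p_def ab prod_eq_iff)
      have "\<mu> / 2 \<le> \<eta> * \<delta>\<^sup>2" using \<mu> by (simp add: \<mu>_def)
      then have "q \<in> K" unfolding q_eq
        using k[OF ab(2)] k[OF ab(3)] b \<eta>\<delta> by (intro slab(1)) linarith+
      moreover have "norm (fst q - x) \<le> norm (zs - x) + (norm ((real a * \<mu>) *\<^sub>R e) + norm \<zeta>)"
        using norm_triangle_ineq[of "zs - x" "(real a * \<mu>) *\<^sub>R e + \<zeta>"]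
          norm_triangle_ineq[of "(real a * \<mu>) *\<^sub>R e" \<zeta>]
        by (simp add: q_eq algebra_simps)
      then have "norm (fst q - x) \<le> (Z + 1) * \<delta> + \<delta>"
        using slab(4,5) k[OF ab(2)] b \<eta>\<delta> \<delta> by (simp only: norm_scaleR)
      then have "norm (fst q - x) \<le> (Z + C + 8) * \<delta>"
        using ZC \<delta> mult_nonneg_nonneg[of C \<delta>] unfolding distrib_right by linarith
      moreover have "snd q = ts + (real b * \<mu> + \<tau>)" by (simp add: q_eq)
      then have sq: "\<delta> / 8 \<le> snd q" "snd q \<le> C * \<delta> + \<delta>"
        using slab(2,3) k[OF ab(3)] b \<eta>\<delta> \<delta> by linarith+
      have "8 * snd q \<le> (Z + C + 8) * snd q" using ZC sq \<delta> by (intro mult_right_mono) auto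
      then have "\<delta> \<le> (Z + C + 8) * snd q" using sq by simp
      moreover have "snd q \<le> (Z + C + 8) * \<delta>"
        using sq ZC \<delta> mult_nonneg_nonneg[of Z \<delta>] unfolding distrib_right by linarith
      ultimately show ?thesis by blast
    qed
    have disj: "i = j" if ij: "i \<in> I" "j \<in> I" and q: "q \<in> hball (p i) r" "q \<in> hball (p j) r" for i j q
    proof -
      obtain a b a' b' where i: "i = (a, b)" and j: "j = (a', b')" by (cases i, cases j)
      have d: "dist (p i) (p j) < \<mu>"
        using close[OF ij(1) q(1)] close[OF ij(2) q(2)] dist_triangle2[of "p i" "p j" q] by simp
      have nat: "real u = real u'" if "\<bar>real u - real u'\<bar> * \<mu> < \<mu>" for u u' :: nat
        using that \<mu> by auto
      have "dist (fst (p i)) (fst (p j)) = \<bar>real a - real a'\<bar> * \<mu>"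
      proof -
        have "fst (p i) - fst (p j) = ((real a - real a') * \<mu>) *\<^sub>R e"
          by (simp add: p_def i j left_diff_distrib scaleR_diff_left)
        then show ?thesis using slab(5) \<mu> by (simp add: dist_norm abs_mult)
      qed
      moreover have "dist (snd (p i)) (snd (p j)) = \<bar>real b - real b'\<bar> * \<mu>"
        using \<mu> by (simp add: p_def i j dist_real_def left_diff_distrib[symmetric] abs_mult)
      ultimately have "\<bar>real a - real a'\<bar> * \<mu> < \<mu>" "\<bar>real b - real b'\<bar> * \<mu> < \<mu>"
        using d dist_fst_le[of "p i" "p j"] dist_snd_le[of "p i" "p j"] by linarith+
      then show ?thesis using nat by (simp add: i j)
    qed
    define U where "U = (\<Union>i\<in>I. hball (f (p i)) r)"
    have U_iff: "q \<in> hball (f (p i)) r \<longleftrightarrow> q \<in> hyp_space \<and> f q \<in> hball (p i) r" if "i \<in> I" for i q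
      using hball_isometry_iff[of f, OF f pH[OF that]] by blast
    have "open U" unfolding U_def using pH f by (intro open_UN ballI open_hball) auto
    moreover have "U \<subseteq> {q \<in> hyp_space. f q \<in> K \<and> norm (fst (f q) - x) \<le> (Z + C + 8) * \<delta>
          \<and> \<delta> \<le> (Z + C + 8) * snd (f q) \<and> snd (f q) \<le> (Z + C + 8) * \<delta>}"
    proof
      fix q assume "q \<in> U"
      then obtain i where "i \<in> I" "q \<in> hball (f (p i)) r" unfolding U_def by blast
      then have "q \<in> hyp_space" "i \<in> I" "f q \<in> hball (p i) r" using U_iff by blast+
      with near[OF this(2,3)] show "q \<in> {q \<in> hyp_space. f q \<in> K \<and> norm (fst (f q) - x) \<le> (Z + C + 8) * \<delta>
          \<and> \<delta> \<le> (Z + C + 8) * snd (f q) \<and> snd (f q) \<le> (Z + C + 8) * \<delta>}" by simp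
    qed
    moreover have "ennreal (v * \<kappa> ^ 3 * \<delta>) \<le> hyp_volume U"
    proof -
      \<comment> \<open>\<open>{..n}\<close> has \<open>n + 1\<close> elements, which makes up for
        the rounding down in \<open>n\<close>.\<close>
      have "1 / \<delta> \<le> real (Suc n)" using \<delta> unfolding n_def by simp linarith
      then have "(1 / \<delta>)\<^sup>2 \<le> (real (Suc n))\<^sup>2" using \<delta> by (intro power_mono) auto
      moreover have "real (card I) = (real (Suc n))\<^sup>2" by (simp add: I_def power2_eq_square algebra_simps)
      ultimately have "v * r ^ 3 * (1 / \<delta>)\<^sup>2 \<le> v * r ^ 3 * real (card I)"
        using v r \<open>real (card I) = (real (Suc n))\<^sup>2\<close> by (intro mult_left_mono) auto
      moreover have "v * r ^ 3 * (1 / \<delta>)\<^sup>2 = v * \<kappa> ^ 3 * \<delta>"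
        using \<delta> by (simp add: r_def power2_eq_square power3_eq_cube)
      ultimately have "ennreal (v * \<kappa> ^ 3 * \<delta>) \<le> ennreal (real (card I) * (v * r ^ 3))"
        by (simp add: ennreal_leI mult.commute)
      also have "\<dots> = (\<Sum>i\<in>I. ennreal (v * r ^ 3))"
        using v r by (simp add: ennreal_mult ennreal_of_nat_eq_real_of_nat)
      also have "\<dots> \<le> (\<Sum>i\<in>I. hyp_volume (hball (f (p i)) r))"
        using f pH r by (intro sum_mono v(2)) auto
      also have "\<dots> \<le> of_nat 1 * hyp_volume U"
      proof (rule sum_hyp_volume_le)
        show "finite I" by (simp add: I_def)
        show "card {i \<in> I. q \<in> hball (f (p i)) r} \<le> 1" for q
        proof -
          have "\<forall>i\<in>{i \<in> I. q \<in> hball (f (p i)) r}. \<forall>j\<in>{i \<in> I. q \<in> hball (f (p i)) r}. i = j"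
            using disj U_iff by blast
          moreover have "finite {i \<in> I. q \<in> hball (f (p i)) r}" by (simp add: I_def)
          ultimately show ?thesis unfolding One_nat_def by (subst card_le_Suc0_iff_eq)
        qed
        show "open (hball (f (p i)) r)" if "i \<in> I" for i by (rule open_hball[OF f(1)[OF pH[OF that]]])
        show "hball (f (p i)) r \<subseteq> U" if "i \<in> I" for i unfolding U_def using that by blast
      qed
      finally show ?thesis by simp
    qed
    ultimately show "\<exists>U. open U \<and> U \<subseteq> {q \<in> hyp_space. f q \<in> K \<and> norm (fst (f q) - x) \<le> (Z + C + 8) * norm (x - y)
          \<and> norm (x - y) \<le> (Z + C + 8) * snd (f q) \<and> snd (f q) \<le> (Z + C + 8) * norm (x - y)}
        \<and> ennreal (v * \<kappa> ^ 3 * norm (x - y)) \<le> hyp_volume U"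
      unfolding \<delta>_def by blast
  qed
qed

subsection \<open>Separated sets\<close>

definition separated :: "real \<Rightarrow> 'a :: metric_space set \<Rightarrow> bool" where
  "separated s F \<longleftrightarrow> pairwise (\<lambda>x y. s \<le> dist x y) F"

lemma separatedD: "separated s F \<Longrightarrow> x \<in> F \<Longrightarrow> y \<in> F \<Longrightarrow> x \<noteq> y \<Longrightarrow> s \<le> dist x y"
  by (auto simp: separated_def pairwise_def)

lemma separated_subset: "separated s F \<Longrightarrow> G \<subseteq> F \<Longrightarrow> separated s G"
  unfolding separated_def by (rule pairwise_subset)

text \<open>Rescaling by \<open>1 / s\<close> reduces all cases to one compact ball, so
  \<open>M\<close> depends on \<open>R\<close> alone; this uniformity gives the same overlap bound
  at every level.\<close>

lemma card_separated_le:
  fixes R :: real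
  obtains M where "\<And>z s (F :: 'a :: euclidean_space set).
    0 < s \<Longrightarrow> F \<subseteq> cball z (R * s) \<Longrightarrow> separated s F \<Longrightarrow> finite F \<and> card F \<le> M"
proof -
  have "compact (cball 0 R :: 'a set)" by simp
  then obtain k :: "'a set" where k: "finite k" "cball 0 R \<subseteq> (\<Union>x\<in>k. ball x (1 / 2))"
    unfolding compact_eq_totally_bounded by (metis half_gt_zero_iff zero_less_one)
  show thesis
  proof
    fix z s and F :: "'a set"
    assume s: "0 < s" and F: "F \<subseteq> cball z (R * s)" "separated s F"
    define h where "h x = (1 / s) *\<^sub>R (x - z)" for x
    have "\<exists>c\<in>k. h x \<in> ball c (1 / 2)" if "x \<in> F" for x
    proof -
      have "norm (x - z) \<le> R * s" using that F by (auto simp: dist_norm norm_minus_commute)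
      then have "norm (h x) \<le> R" unfolding h_def norm_scaleR using s by (simp add: field_simps)
      then have "h x \<in> cball 0 R" by simp
      then show ?thesis using k by blast
    qed
    then obtain g where g: "\<And>x. x \<in> F \<Longrightarrow> g x \<in> k \<and> h x \<in> ball (g x) (1 / 2)" by metis
    have "inj_on g F"
    proof (rule inj_onI, rule ccontr)
      fix x y assume xy: "x \<in> F" "y \<in> F" "g x = g y" "x \<noteq> y"
      then have "dist (h x) (h y) < 1"
        using g[of x] g[of y] dist_triangle_half_r[of "g x" "h x" 1 "h y"] by simp
      moreover have "h x - h y = (1 / s) *\<^sub>R (x - y)" by (simp add: h_def algebra_simps)
      then have "dist (h x) (h y) = dist x y / s" using s by (simp add: dist_norm)
      ultimately have "dist x y < s" using s by (simp add: field_simps)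
      then show False using separatedD[OF F(2) xy(1,2,4)] by simp
    qed
    moreover have "g ` F \<subseteq> k" using g by blast
    ultimately show "finite F \<and> card F \<le> card k"
      using k(1) by (auto intro: inj_on_finite card_inj_on_le)
  qed
qed

text \<open>\<open>Max\<close> is meaningful here for bounded \<open>A\<close> and positive
  \<open>s\<close>, where cardinalities of separated subsets are bounded.\<close>

definition sep_num :: "real \<Rightarrow> 'a :: metric_space set \<Rightarrow> nat" where
  "sep_num s A = Max (card ` {F. finite F \<and> F \<subseteq> A \<and> separated s F})"

lemma
  fixes A :: "'a :: euclidean_space set"
  assumes "bounded A" "0 < s"
  shows card_le_sep_num: "F \<subseteq> A \<Longrightarrow> separated s F \<Longrightarrow> finite F \<and> card F \<le> sep_num s A"
    and sep_num_attained: "\<exists>F. finite F \<and> F \<subseteq> A \<and> separated s F \<and> card F = sep_num s A"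
proof -
  obtain B where B: "A \<subseteq> cball 0 B"
    using assms(1) by (metis bounded_iff mem_cball_0 subsetI)
  obtain M where M: "\<And>z r (F :: 'a set).
    0 < r \<Longrightarrow> F \<subseteq> cball z (B / s * r) \<Longrightarrow> separated r F \<Longrightarrow> finite F \<and> card F \<le> M"
    using card_separated_le[of "B / s"] by blast
  have fin: "finite F \<and> card F \<le> M" if "F \<subseteq> A" "separated s F" for F
    using M[OF assms(2) _ that(2), of 0] that(1) B assms(2) by auto
  let ?S = "card ` {F. finite F \<and> F \<subseteq> A \<and> separated s F}"
  have "?S \<subseteq> {..M}" using fin by auto
  then have S: "finite ?S" by (rule finite_subset) simp
  show "F \<subseteq> A \<Longrightarrow> separated s F \<Longrightarrow> finite F \<and> card F \<le> sep_num s A"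
    unfolding sep_num_def using fin by (auto intro!: Max_ge[OF S])
  have "separated s ({} :: 'a set)" by (simp add: separated_def)
  then have "?S \<noteq> {}" by blast
  from Max_in[OF S this] show "\<exists>F. finite F \<and> F \<subseteq> A \<and> separated s F \<and> card F = sep_num s A"
    unfolding sep_num_def by auto
qed

text \<open>Remove a maximal \<open>s\<close>-separated subset from a largest \<open>s'\<close>-separated one: by maximality each
  remaining point has a partner at distance between \<open>s'\<close> and \<open>s\<close>.\<close>

lemma branching_points:
  fixes A :: "'a :: euclidean_space set"
  assumes "bounded A" "0 < s'" "0 < s"
  obtains B where "finite B" "B \<subseteq> A" "separated s' B" "sep_num s' A \<le> sep_num s A + card B"
    "\<And>x. x \<in> B \<Longrightarrow> \<exists>y\<in>A. s' \<le> dist x y \<and> dist x y < s"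
proof -
  obtain F where F: "finite F" "F \<subseteq> A" "separated s' F" "card F = sep_num s' A"
    using sep_num_attained[OF assms(1,2)] by blast
  have "finite {G \<in> Pow F. separated s G}" "{} \<in> {G \<in> Pow F. separated s G}"
    using F by (auto simp: separated_def)
  from finite_has_maximal2[OF this] obtain G where
    G: "G \<subseteq> F" "separated s G" "\<And>H. H \<subseteq> F \<Longrightarrow> separated s H \<Longrightarrow> G \<subseteq> H \<Longrightarrow> G = H"
    by auto
  show thesis
  proof
    show "finite (F - G)" "F - G \<subseteq> A" "separated s' (F - G)"
      using F by (auto intro: separated_subset)
    have "card G \<le> sep_num s A" using card_le_sep_num[OF assms(1,3)] G F by blast
    then show "sep_num s' A \<le> sep_num s A + card (F - G)"
      using F G by (simp add: card_Diff_subset finite_subset card_mono)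
    fix x assume x: "x \<in> F - G"
    have "\<not> separated s (insert x G)" using G(3)[of "insert x G"] x G(1) by blast
    then obtain y where "y \<in> G" "dist x y < s" "x \<noteq> y"
      using G(2) unfolding separated_def pairwise_insert by (auto simp: dist_commute not_le)
    then show "\<exists>y\<in>A. s' \<le> dist x y \<and> dist x y < s"
      using separatedD[OF F(3), of x y] x G(1) F(2) by blast
  qed
qed

text \<open>For geometric weights the sum of \<open>s (Suc j) * n j\<close> is \<open>l\<close>
  times that of \<open>s j * n j\<close>, and an index shift costs only \<open>s 0 * n 0\<close>.
  Hence \<open>(1 - l)\<close> times the sum is at most \<open>W + s 0 * n 0\<close>, independently
  of \<open>J\<close>.\<close>

lemma partial_sums_le:
  fixes s n :: "nat \<Rightarrow> real"
  assumes "0 < l" "l < 1" "\<And>j. s (Suc j) = l * s j" "0 \<le> s 0" "\<And>j. 0 \<le> n j"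
    and W: "(\<Sum>j<J. s (Suc j) * (n (Suc j) - n j)) \<le> W"
  shows "(\<Sum>j<J. s j * n j) \<le> (W + s 0 * n 0) / (1 - l)"
proof -
  have s: "0 \<le> s j" for j by (induction j) (use assms in auto)
  have "(\<Sum>j<J. s (Suc j) * (n (Suc j) - n j)) = (\<Sum>j<J. s (Suc j) * n (Suc j)) - l * (\<Sum>j<J. s j * n j)"
    unfolding assms(3) by (simp add: right_diff_distrib sum_subtractf sum_distrib_left mult.assoc)
  moreover have "(\<Sum>j<J. s j * n j) \<le> s 0 * n 0 + (\<Sum>j<J. s (Suc j) * n (Suc j))"
  proof -
    have "(\<Sum>j<J. s j * n j) \<le> (\<Sum>j<Suc J. s j * n j)" using s assms(5) by simp
    also have "\<dots> = s 0 * n 0 + (\<Sum>j<J. s (Suc j) * n (Suc j))" by (rule sum.lessThan_Suc_shift)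
    finally show ?thesis .
  qed
  ultimately have "(1 - l) * (\<Sum>j<J. s j * n j) \<le> W + s 0 * n 0"
    using W by (simp add: algebra_simps)
  then show ?thesis using assms(2) by (simp add: field_simps)
qed

subsection \<open>Volume contributed by branching points\<close>

text \<open>The height of \<open>f q\<close> determines the level of a region containing
  \<open>q\<close> up to \<open>L\<close> consecutive values, and its horizontal position leaves at
  most \<open>N\<close> separated centres on each level; this gives multiplicity at most
  \<open>L * N\<close>.\<close>

lemma branching_volume:
  fixes f :: "complex \<times> real \<Rightarrow> complex \<times> real" and A :: "complex set" and l :: real
  defines "s \<equiv> \<lambda>j. l ^ Suc j / 6"
  assumes K: "K \<subseteq> hyp_space" "convex (para ` K)" "interior (para ` K) \<noteq> {}"
    and f: "\<And>p. p \<in> hyp_space \<Longrightarrow> f p \<in> hyp_space"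
      "\<And>p. p \<in> hyp_space \<Longrightarrow> f (f p) = p"
      "\<And>p q. p \<in> hyp_space \<Longrightarrow> q \<in> hyp_space \<Longrightarrow> hyp_dist (f p) (f q) = hyp_dist p q"
    and A: "A \<subseteq> cball 0 1"
    and seg: "\<And>x y a. x \<in> A \<Longrightarrow> y \<in> A \<Longrightarrow> x \<noteq> y \<Longrightarrow> 0 < a \<Longrightarrow> a < 1 \<Longrightarrow>
        (1 - a) *\<^sub>R (x, (norm x)\<^sup>2) + a *\<^sub>R (y, (norm y)\<^sup>2) \<in> para ` K"
    and l: "0 < l" "l < 1"
  obtains \<kappa> M where "0 < \<kappa>"
    "\<And>J. (\<Sum>j<J. ennreal (\<kappa> * s (Suc j)) * of_nat (sep_num (s (Suc j)) A - sep_num (s j) A))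
      \<le> of_nat M * hyp_volume {q \<in> hyp_space. f q \<in> K}"
proof -
  obtain \<kappa> C where \<kappa>: "0 < \<kappa>" and C: "1 \<le> C"
    and patch: "\<And>x y. norm x \<le> 1 \<Longrightarrow> norm y \<le> 1 \<Longrightarrow> x \<noteq> y \<Longrightarrow> norm (x - y) \<le> 1 / 2 \<Longrightarrow>
      (\<And>a. 0 < a \<Longrightarrow> a < 1 \<Longrightarrow>
        (1 - a) *\<^sub>R (x, (norm x)\<^sup>2) + a *\<^sub>R (y, (norm y)\<^sup>2) \<in> para ` K) \<Longrightarrow>
      \<exists>U. open U \<and> U \<subseteq> {q \<in> hyp_space. f q \<in> K \<and> norm (fst (f q) - x) \<le> C * norm (x - y)
          \<and> norm (x - y) \<le> C * snd (f q) \<and> snd (f q) \<le> C * norm (x - y)}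
        \<and> ennreal (\<kappa> * norm (x - y)) \<le> hyp_volume U"
    using patch_volume[OF K f] by blast
  have s: "0 < s j" "s j \<le> 1 / 2" "s (Suc j) = l * s j" for j
    using l power_le_one[of l "Suc j"] by (auto simp: s_def)
  have bA: "bounded A" using A by (rule bounded_subset[OF bounded_cball])
  have "\<exists>B. finite B \<and> B \<subseteq> A \<and> separated (s (Suc j)) B \<and> sep_num (s (Suc j)) A \<le> sep_num (s j) A + card B
      \<and> (\<forall>x\<in>B. \<exists>y\<in>A. s (Suc j) \<le> dist x y \<and> dist x y < s j)" for j
    using branching_points[OF bA s(1)[of "Suc j"] s(1)[of j]] by metis
  then obtain B where B: "\<And>j. finite (B j)" "\<And>j. B j \<subseteq> A" "\<And>j. separated (s (Suc j)) (B j)"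
    "\<And>j. sep_num (s (Suc j)) A \<le> sep_num (s j) A + card (B j)"
    "\<And>j x. x \<in> B j \<Longrightarrow> \<exists>y\<in>A. s (Suc j) \<le> dist x y \<and> dist x y < s j"
    by metis
  \<comment> \<open>The region is enlarged so that its bounds depend on the level only, not on the
    distance to the partner.\<close>
  define G where "G j x = {q \<in> hyp_space. f q \<in> K \<and> norm (fst (f q) - x) \<le> C * s j
          \<and> s (Suc j) \<le> C * snd (f q) \<and> snd (f q) \<le> C * s j}" for j x
  have "\<exists>U. open U \<and> U \<subseteq> G j x \<and> ennreal (\<kappa> * s (Suc j)) \<le> hyp_volume U" if x: "x \<in> B j" for j x
  proof -
    obtain y where y: "y \<in> A" "s (Suc j) \<le> norm (x - y)" "norm (x - y) < s j"
      using B(5)[OF x] by (auto simp: dist_norm)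
    have xA: "x \<in> A" using B(2) x by blast
    have "x \<noteq> y" using y s(1)[of "Suc j"] by auto
    moreover have "norm (x - y) \<le> 1 / 2" using y s(2)[of j] by simp
    moreover have "norm x \<le> 1" "norm y \<le> 1" using A xA y by auto
    ultimately obtain U where U: "open U" "U \<subseteq> {q \<in> hyp_space. f q \<in> K \<and> norm (fst (f q) - x) \<le> C * norm (x - y)
          \<and> norm (x - y) \<le> C * snd (f q) \<and> snd (f q) \<le> C * norm (x - y)}"
      "ennreal (\<kappa> * norm (x - y)) \<le> hyp_volume U"
      using patch[of x y] seg[OF xA y(1)] by blast
    have "C * norm (x - y) \<le> C * s j" using C y by simp
    then have "U \<subseteq> G j x"
      using U(2) y(2) unfolding G_def by (auto intro: order_trans)
    moreover have "ennreal (\<kappa> * s (Suc j)) \<le> ennreal (\<kappa> * norm (x - y))"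
      using y(2) \<kappa> by (intro ennreal_leI mult_left_mono) auto
    ultimately show ?thesis using U(1,3) order_trans by blast
  qed
  note U_ex = this
  define U where
    "U j x = (SOME U. open U \<and> U \<subseteq> G j x \<and> ennreal (\<kappa> * s (Suc j)) \<le> hyp_volume U)" for j x
  have U: "open (U j x)" "U j x \<subseteq> G j x" "ennreal (\<kappa> * s (Suc j)) \<le> hyp_volume (U j x)"
    if "x \<in> B j" for j x
    using someI_ex[OF U_ex[OF that]] unfolding U_def by blast+
  \<comment> \<open>Centres on level \<open>j\<close> lie within \<open>C * s j\<close> but are only
    \<open>s (Suc j) = l * s j\<close> apart, whence the ratio \<open>C / l\<close>.\<close>
  obtain N where N: "\<And>z r (F :: complex set).
    0 < r \<Longrightarrow> F \<subseteq> cball z (C / l * r) \<Longrightarrow> separated r F \<Longrightarrow> finite F \<and> card F \<le> N"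
    using card_separated_le[of "C / l"] by blast
  have "0 < l / C\<^sup>2" using C l by simp
  \<comment> \<open>If levels \<open>j0\<close> and \<open>j0 + d\<close> both reach height
    \<open>t\<close>, then \<open>l * s j0 \<le> C * t\<close> and
    \<open>t \<le> C * l ^ d * s j0\<close>, so \<open>l ^ d\<close> is at least
    \<open>l / C\<^sup>2\<close>.\<close>
  then obtain L where L: "l ^ L < l / C\<^sup>2" using real_arch_pow_inv l(2) by blast
  have overlap: "card {i \<in> Sigma {..<J} B. q \<in> case_prod U i} \<le> L * N" for J q
  proof -
    define z t where "z = fst (f q)" and "t = snd (f q)"
    define Js where "Js = {j. j < J \<and> s (Suc j) \<le> C * t \<and> t \<le> C * s j}"
    define Xs where "Xs j = {x \<in> B j. norm (z - x) \<le> C * s j}" for j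
    have sub: "{i \<in> Sigma {..<J} B. q \<in> case_prod U i} \<subseteq> Sigma Js Xs"
    proof (clarsimp simp: Js_def Xs_def)
      fix j x assume "x \<in> B j" "q \<in> U j x"
      then have "q \<in> G j x" using U(2) by blast
      then show "s (Suc j) \<le> C * t \<and> t \<le> C * s j \<and> norm (z - x) \<le> C * s j"
        by (simp add: G_def z_def t_def)
    qed
    have Xs: "finite (Xs j)" "card (Xs j) \<le> N" for j
    proof -
      have "Xs j \<subseteq> cball z (C / l * s (Suc j))" using l by (auto simp: Xs_def s(3) dist_norm)
      moreover have "separated (s (Suc j)) (Xs j)"
        by (rule separated_subset[OF B(3)[of j]]) (auto simp: Xs_def)
      ultimately show "finite (Xs j)" "card (Xs j) \<le> N" using N[OF s(1)[of "Suc j"]] by blast+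
    qed
    have "finite Js" by (simp add: Js_def)
    have "card Js \<le> L"
    proof (cases "Js = {}")
      case False
      define j0 where "j0 = Min Js"
      have j0: "j0 \<in> Js" using Min_in[OF \<open>finite Js\<close> False] by (simp add: j0_def)
      have "j \<in> {j0..<j0 + L}" if j: "j \<in> Js" for j
      proof -
        have "j0 \<le> j" using \<open>finite Js\<close> j by (simp add: j0_def)
        then obtain d where d: "j = j0 + d" by (metis le_iff_add)
        have sd: "s (j0 + d) = l ^ d * s j0" by (simp add: s_def power_add)
        have "l * s j0 \<le> C * t" using j0 by (simp add: Js_def s(3))
        also have "\<dots> \<le> C * (C * (l ^ d * s j0))"
          using j C unfolding d sd[symmetric] by (simp add: Js_def)
        finally have "l \<le> C\<^sup>2 * l ^ d" using s(1)[of j0] by (simp add: power2_eq_square mult.assoc[symmetric])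
        then have "l / C\<^sup>2 \<le> l ^ d" using C by (simp add: divide_le_eq mult.commute)
        then have "l ^ L < l ^ d" using L by simp
        then have "d < L" using l by (meson linorder_not_less not_le power_decreasing less_imp_le)
        then show ?thesis by (simp add: d)
      qed
      then have "Js \<subseteq> {j0..<j0 + L}" by blast
      from card_mono[OF _ this] show ?thesis by simp
    qed simp
    have "card {i \<in> Sigma {..<J} B. q \<in> case_prod U i} \<le> card (Sigma Js Xs)"
      using sub \<open>finite Js\<close> Xs by (intro card_mono) auto
    also have "\<dots> = (\<Sum>j\<in>Js. card (Xs j))" using \<open>finite Js\<close> Xs by simp
    also have "\<dots> \<le> (\<Sum>j\<in>Js. N)" using Xs by (intro sum_mono) auto
    also have "\<dots> \<le> L * N" using \<open>card Js \<le> L\<close> by simp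
    finally show ?thesis .
  qed
  show thesis
  proof
    show "0 < \<kappa>" by fact
    fix J
    have "(\<Sum>j<J. ennreal (\<kappa> * s (Suc j)) * of_nat (sep_num (s (Suc j)) A - sep_num (s j) A))
        \<le> (\<Sum>j<J. ennreal (\<kappa> * s (Suc j)) * of_nat (card (B j)))"
      using B(4) by (intro sum_mono mult_left_mono) (auto simp: le_diff_conv add.commute)
    also have "\<dots> = (\<Sum>j<J. \<Sum>x\<in>B j. ennreal (\<kappa> * s (Suc j)))" by (simp add: mult.commute)
    also have "\<dots> \<le> (\<Sum>j<J. \<Sum>x\<in>B j. hyp_volume (U j x))" using U(3) by (intro sum_mono) auto
    also have "\<dots> = (\<Sum>i\<in>Sigma {..<J} B. hyp_volume (case_prod U i))"
      using B(1) by (subst sum.Sigma) (auto intro!: sum.cong)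
    also have "\<dots> \<le> of_nat (L * N) * hyp_volume {q \<in> hyp_space. f q \<in> K}"
    proof (rule sum_hyp_volume_le)
      show "finite (Sigma {..<J} B)" using B(1) by simp
      show "open (case_prod U i)" if "i \<in> Sigma {..<J} B" for i using that U(1) by auto
      show "case_prod U i \<subseteq> {q \<in> hyp_space. f q \<in> K}" if i: "i \<in> Sigma {..<J} B" for i
      proof -
        obtain j x where "i = (j, x)" "x \<in> B j" using i by blast
        then show ?thesis using U(2)[of x j] by (auto simp: G_def)
      qed
    qed (rule overlap)
    finally show "(\<Sum>j<J. ennreal (\<kappa> * s (Suc j)) * of_nat (sep_num (s (Suc j)) A - sep_num (s j) A))
      \<le> of_nat (L * N) * hyp_volume {q \<in> hyp_space. f q \<in> K}" .
  qed
qed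

subsection \<open>Spherical packings\<close>

text \<open>Reflection of the sphere in its equatorial plane, the reason why the inversion is a
  spherical isometry.\<close>

lemma stereographic_inv_ideal_inversion:
  "stereographic_inv (ideal_inversion x)
    = (fst (stereographic_inv x), - snd (stereographic_inv x))"
proof (cases x)
  case (Some a)
  show ?thesis
  proof (cases "a = 0")
    case False
    define c where "c = (norm a)\<^sup>2"
    have c: "0 < c" using False by (simp add: c_def)
    have "(norm ((1 / c) *\<^sub>R a))\<^sup>2 = 1 / c"
      unfolding norm_scaleR power_mult_distrib c_def[symmetric] using c by (simp add: power2_eq_square)
    then have "stereographic_inv (ideal_inversion x) = ((2 / (1 + 1 / c)) *\<^sub>R (1 / c) *\<^sub>R a, (1 / c - 1) / (1 / c + 1))"
      using Some False
      unfolding ideal_inversion_def stereographic_inv_def by (simp add: c_def del: norm_scaleR)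
    also have "\<dots> = ((2 / (1 + c)) *\<^sub>R a, - ((c - 1) / (c + 1)))"
      using c by (simp add: divide_simps)
    finally show ?thesis using Some by (simp add: stereographic_inv_def c_def)
  qed (simp add: Some stereographic_inv_def ideal_inversion_def)
qed (simp add: stereographic_inv_def ideal_inversion_def)

lemma spherical_dist_ideal_inversion:
  "spherical_dist (ideal_inversion x) (ideal_inversion y) = spherical_dist x y"
  by (cases "stereographic_inv x", cases "stereographic_inv y")
    (simp add: spherical_dist_def stereographic_inv_ideal_inversion inner_prod_def)

text \<open>The formula for the chordal metric: one minus the inner product of unit vectors is half
  the squared chord.\<close>

lemma stereographic_inv_inner:
  "stereographic_inv (Some z) \<bullet> stereographic_inv (Some w)
    = 1 - 2 * (norm (z - w))\<^sup>2 / ((1 + (norm z)\<^sup>2) * (1 + (norm w)\<^sup>2))"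
proof -
  define a b c where "a = (norm z)\<^sup>2" and "b = (norm w)\<^sup>2" and "c = z \<bullet> w"
  have pos: "0 < 1 + a" "0 < 1 + b" by (auto simp: a_def b_def intro: add_pos_nonneg)
  have "(norm (z - w))\<^sup>2 = a + b - 2 * c"
    unfolding a_def b_def c_def power2_norm_eq_inner
    by (simp add: inner_diff_left inner_diff_right inner_commute)
  moreover have "stereographic_inv (Some z) \<bullet> stereographic_inv (Some w)
      = 2 / (1 + a) * (2 / (1 + b) * c) + (a - 1) / (1 + a) * ((b - 1) / (1 + b))"
    by (simp add: stereographic_inv_def a_def b_def c_def add.commute)
  moreover have "2 / (1 + a) * (2 / (1 + b) * c) + (a - 1) / (1 + a) * ((b - 1) / (1 + b))
      = 1 - 2 * (a + b - 2 * c) / ((1 + a) * (1 + b))"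
    using pos by (simp add: divide_simps) (simp add: algebra_simps)
  ultimately show ?thesis by (simp add: a_def b_def)
qed

lemma spherical_dist_self: "spherical_dist x x = 0"
proof (cases x)
  case (Some z)
  then show ?thesis by (simp add: spherical_dist_def stereographic_inv_inner)
qed (simp add: spherical_dist_def stereographic_inv_def)

text \<open>Third-order Taylor bound with \<open>x * x \<le> 4\<close>; the range is chosen to
  contain \<open>pi / 2\<close>.\<close>

lemma sin_ge_third:
  assumes "0 \<le> x" "x \<le> 2"
  shows "x / 3 \<le> sin (x::real)"
proof -
  have "\<bar>sin x - (\<Sum>m<3. sin_coeff m * x ^ m)\<bar> \<le> inverse (fact 3) * \<bar>x\<bar> ^ 3"
    by (rule Maclaurin_sin_bound)
  then have "\<bar>sin x - x\<bar> \<le> x ^ 3 / 6"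
    using assms by (simp add: numeral_3_eq_3 sin_coeff_def fact_numeral)
  moreover have "x * x \<le> 2 * 2" using assms by (intro mult_mono) auto
  then have "x * (x * x) \<le> x * 4" using assms by (intro mult_left_mono) auto
  then have "x ^ 3 \<le> 4 * x" by (simp add: power3_eq_cube)
  ultimately show ?thesis by linarith
qed

text \<open>By the half-angle formula \<open>sin (\<theta> / 2)\<close> is half the chord, which is
  at most \<open>norm (z - w)\<close>. The constant is 2 for the half angle times 3 from
  \<open>sin_ge_third\<close>.\<close>

lemma spherical_dist_le: "spherical_dist (Some z) (Some w) \<le> 6 * norm (z - w)"
proof -
  define c where "c = stereographic_inv (Some z) \<bullet> stereographic_inv (Some w)"
  define m where "m = (1 + (norm z)\<^sup>2) * (1 + (norm w)\<^sup>2)"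
  define \<theta> where "\<theta> = spherical_dist (Some z) (Some w)"
  have "1 * 1 \<le> m" unfolding m_def by (intro mult_mono) auto
  then have m: "1 \<le> m" by simp
  have c: "c = 1 - 2 * (norm (z - w))\<^sup>2 / m" by (simp add: c_def m_def stereographic_inv_inner)
  \<comment> \<open>This puts \<open>c\<close> into the domain of \<open>arccos\<close>. The gap
    between \<open>m\<close> and \<open>(norm z + norm w)\<^sup>2\<close> is the square of
    \<open>norm z * norm w - 1\<close>.\<close>
  have "(norm (z - w))\<^sup>2 \<le> m"
  proof -
    have "(norm (z - w))\<^sup>2 \<le> (norm z + norm w)\<^sup>2"
      by (intro power_mono norm_triangle_ineq4) simp
    also have "\<dots> \<le> m"
      using zero_le_power2[of "norm z * norm w - 1"]
      by (simp add: m_def power2_eq_square algebra_simps)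
    finally show ?thesis .
  qed
  then have c1: "-1 \<le> c" "c \<le> 1" using m by (auto simp: c field_simps)
  then have cos: "cos \<theta> = c" and \<theta>: "0 \<le> \<theta>" "\<theta> \<le> pi"
    by (auto simp: \<theta>_def spherical_dist_def c_def[symmetric] arccos_lbound arccos_ubound)
  have "1 - 2 * (sin (\<theta> / 2))\<^sup>2 = 1 - 2 * (norm (z - w))\<^sup>2 / m"
    using cos cos_double_sin[of "\<theta> / 2"] c by simp
  then have "(sin (\<theta> / 2))\<^sup>2 = (norm (z - w))\<^sup>2 / m" by simp
  also have "\<dots> \<le> (norm (z - w))\<^sup>2" using m by (simp add: divide_le_eq mult_left_le mult_le_cancel_left1)
  finally have "sin (\<theta> / 2) \<le> norm (z - w)" by (rule power2_le_imp_le) simp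
  moreover have "\<theta> / 2 / 3 \<le> sin (\<theta> / 2)" using \<theta> pi_less_4 by (intro sin_ge_third) auto
  ultimately show ?thesis by (simp add: \<theta>_def)
qed

definition disc_part :: "riemann_sphere set \<Rightarrow> complex set" where
  "disc_part E = {z. Some z \<in> E \<and> norm z \<le> 1}"

lemma disc_part_subset: "disc_part E \<subseteq> cball 0 1"
  by (auto simp: disc_part_def)

lemma bounded_disc_part: "bounded (disc_part E)"
  using disc_part_subset by (rule bounded_subset[OF bounded_cball])

text \<open>Centres closer than \<epsilon> would lie in each other's balls, so the centres are
  \<open>\<epsilon> / 6\<close> apart in the plane. Each of them lies in the closed unit disc or is
  carried there by the inversion.\<close>

lemma packing_number_le:
  assumes "0 < \<epsilon>"
  shows "packing_number \<epsilon> E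
    \<le> enat (sep_num (\<epsilon> / 6) (disc_part E) + sep_num (\<epsilon> / 6) (disc_part (ideal_inversion ` E)))"
  unfolding packing_number_def
proof (rule SUP_least, safe)
  fix F assume F: "finite F" "F \<subseteq> E" "disjoint_family_on (\<lambda>x. spherical_ball x \<epsilon>) F"
  have far: "\<epsilon> \<le> spherical_dist x y" if "x \<in> F" "y \<in> F" "x \<noteq> y" for x y
  proof (rule ccontr)
    assume "\<not> ?thesis"
    then have "y \<in> spherical_ball x \<epsilon> \<inter> spherical_ball y \<epsilon>"
      using assms by (simp add: spherical_ball_def spherical_dist_self)
    then show False using F(3) that unfolding disjoint_family_on_def by blast
  qed
  have sep: "separated (\<epsilon> / 6) (disc_part F)" "separated (\<epsilon> / 6) (disc_part (ideal_inversion ` F))"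
  proof -
    show "separated (\<epsilon> / 6) (disc_part F)"
      unfolding separated_def
    proof (rule pairwiseI)
      fix z w assume "z \<in> disc_part F" "w \<in> disc_part F" "z \<noteq> w"
      then show "\<epsilon> / 6 \<le> dist z w"
        using far[of "Some z" "Some w"] spherical_dist_le[of z w] by (simp add: disc_part_def dist_norm)
    qed
    show "separated (\<epsilon> / 6) (disc_part (ideal_inversion ` F))"
      unfolding separated_def
    proof (rule pairwiseI)
      fix z w assume "z \<in> disc_part (ideal_inversion ` F)" "w \<in> disc_part (ideal_inversion ` F)" "z \<noteq> w"
      then obtain x y where "x \<in> F" "y \<in> F" "Some z = ideal_inversion x" "Some w = ideal_inversion y"
        unfolding disc_part_def by blast
      moreover from this \<open>z \<noteq> w\<close> have "x \<noteq> y" by (metis option.inject)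
      ultimately show "\<epsilon> / 6 \<le> dist z w"
        using far[of x y] spherical_dist_le[of z w] spherical_dist_ideal_inversion[of x y]
        by (simp add: dist_norm)
    qed
  qed
  have F_sub: "F \<subseteq> Some ` disc_part F \<union> (ideal_inversion \<circ> Some) ` disc_part (ideal_inversion ` F)"
  proof
    fix x assume x: "x \<in> F"
    show "x \<in> Some ` disc_part F \<union> (ideal_inversion \<circ> Some) ` disc_part (ideal_inversion ` F)"
    proof (cases "x \<in> Some ` disc_part F")
      case False
      have "\<exists>w. ideal_inversion x = Some w \<and> norm w \<le> 1"
      proof (cases x)
        case (Some a)
        then have "1 < norm a" using False x by (auto simp: disc_part_def)
        then show ?thesis using Some by (auto simp: ideal_inversion_def power2_eq_square divide_le_eq)
      qed (simp add: ideal_inversion_def)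
      then obtain w where w: "ideal_inversion x = Some w" "norm w \<le> 1" by blast
      then have "w \<in> disc_part (ideal_inversion ` F)"
        using x by (simp add: disc_part_def) (metis imageI)
      moreover have "x = ideal_inversion (Some w)" using w by (metis ideal_inversion_ideal_inversion)
      ultimately show ?thesis by auto
    qed simp
  qed
  have sub: "disc_part F \<subseteq> disc_part E" "disc_part (ideal_inversion ` F) \<subseteq> disc_part (ideal_inversion ` E)"
    using F(2) by (auto simp: disc_part_def)
  have n: "finite (disc_part F)" "card (disc_part F) \<le> sep_num (\<epsilon> / 6) (disc_part E)"
    "finite (disc_part (ideal_inversion ` F))"
    "card (disc_part (ideal_inversion ` F)) \<le> sep_num (\<epsilon> / 6) (disc_part (ideal_inversion ` E))"
    using card_le_sep_num[OF bounded_disc_part _ sub(1) sep(1)]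
      card_le_sep_num[OF bounded_disc_part _ sub(2) sep(2)] assms by auto
  have "card F \<le> card (Some ` disc_part F \<union> (ideal_inversion \<circ> Some) ` disc_part (ideal_inversion ` F))"
    using F_sub n by (intro card_mono) auto
  also have "\<dots> \<le> card (disc_part F) + card (disc_part (ideal_inversion ` F))"
    using n by (intro order_trans[OF card_Un_le] add_mono card_image_le) auto
  finally show "enat (card F)
    \<le> enat (sep_num (\<epsilon> / 6) (disc_part E) + sep_num (\<epsilon> / 6) (disc_part (ideal_inversion ` E)))"
    using n by simp
qed

subsection \<open>Packing numbers and volume\<close>

text \<open>Finite volume bounds the weighted increments of \<open>sep_num\<close>, hence by
  summation by parts the partial sums, uniformly in their length. The involution \<open>f\<close>
  allows the volume to be that of the original hull while \<open>E\<close> is replaced by its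
  inverted copy.\<close>

lemma weighted_sep_num_sum_finite:
  fixes f :: "complex \<times> real \<Rightarrow> complex \<times> real" and E :: "riemann_sphere set" and l :: real
  assumes int: "interior (CH E) \<noteq> {}"
    and f: "\<And>p. p \<in> hyp_space \<Longrightarrow> f p \<in> hyp_space"
      "\<And>p. p \<in> hyp_space \<Longrightarrow> f (f p) = p"
      "\<And>p q. p \<in> hyp_space \<Longrightarrow> q \<in> hyp_space \<Longrightarrow> hyp_dist (f p) (f q) = hyp_dist p q"
    and fin: "hyp_volume {q \<in> hyp_space. f q \<in> CH E} < \<infinity>"
    and l: "0 < l" "l < 1"
  shows "(\<Sum>j. ennreal (l ^ Suc j * real (sep_num (l ^ Suc j / 6) (disc_part E)))) < \<infinity>"
proof -
  define s where "s j = l ^ Suc j / 6" for j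
  define n where "n j = sep_num (s j) (disc_part E)" for j
  have s: "s (Suc j) = l * s j" "0 < s j" for j using l by (auto simp: s_def)
  have intp: "interior (para ` CH E) \<noteq> {}"
    using int interior_para_image_iff[OF CH_subset_hyp_space] by simp
  have seg: "(1 - a) *\<^sub>R (x, (norm x)\<^sup>2) + a *\<^sub>R (y, (norm y)\<^sup>2) \<in> para ` CH E"
    if "x \<in> disc_part E" "y \<in> disc_part E" "x \<noteq> y" "0 < a" "a < 1" for x y a
    using that by (intro open_segment_lift_in_para_CH) (auto simp: disc_part_def)
  note branching_volume[OF CH_subset_hyp_space convex_para_image[OF hyp_convex_CH] intp f disc_part_subset seg l]
  then obtain \<kappa> M where \<kappa>: "0 < \<kappa>"
    and vol: "\<And>J. (\<Sum>j<J. ennreal (\<kappa> * s (Suc j)) * of_nat (n (Suc j) - n j))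
      \<le> of_nat M * hyp_volume {q \<in> hyp_space. f q \<in> CH E}"
    unfolding s_def n_def by blast
  obtain V where V: "hyp_volume {q \<in> hyp_space. f q \<in> CH E} = ennreal V" "0 \<le> V"
    using fin by (cases "hyp_volume {q \<in> hyp_space. f q \<in> CH E}") auto
  define W where "W = real M * V / \<kappa>"
  have W: "(\<Sum>j<J. s (Suc j) * (real (n (Suc j)) - real (n j))) \<le> W" for J
  proof -
    have "ennreal (\<Sum>j<J. \<kappa> * s (Suc j) * real (n (Suc j) - n j))
        = (\<Sum>j<J. ennreal (\<kappa> * s (Suc j)) * of_nat (n (Suc j) - n j))"
      using \<kappa> s(2) by (subst sum_ennreal[symmetric])
        (auto simp: ennreal_mult ennreal_of_nat_eq_real_of_nat less_imp_le)
    also have "\<dots> \<le> ennreal (real M * V)"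
      using vol[of J] V by (simp add: ennreal_mult ennreal_of_nat_eq_real_of_nat)
    finally have "(\<Sum>j<J. \<kappa> * s (Suc j) * real (n (Suc j) - n j)) \<le> real M * V"
      using V(2) by simp
    \<comment> \<open>Subtraction on \<open>nat\<close> truncates at zero and so never falls below
      the real difference.\<close>
    moreover have "\<kappa> * (\<Sum>j<J. s (Suc j) * (real (n (Suc j)) - real (n j)))
        \<le> (\<Sum>j<J. \<kappa> * s (Suc j) * real (n (Suc j) - n j))"
      unfolding sum_distrib_left mult.assoc using \<kappa> less_imp_le[OF s(2)]
      by (intro sum_mono mult_left_mono) auto
    ultimately show ?thesis using \<kappa> by (simp add: W_def field_simps)
  qed
  define D where "D = (W + s 0 * real (n 0)) / (1 - l)"
  have D: "(\<Sum>j<J. s j * real (n j)) \<le> D" for J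
    unfolding D_def by (rule partial_sums_le[OF l s(1) less_imp_le[OF s(2)] _ W]) simp
  have "(\<Sum>j<J. ennreal (l ^ Suc j * real (n j))) \<le> ennreal (6 * D)" for J
  proof -
    have "(\<Sum>j<J. ennreal (l ^ Suc j * real (n j))) = ennreal (\<Sum>j<J. l ^ Suc j * real (n j))"
      using l by (intro sum_ennreal) auto
    also have "(\<Sum>j<J. l ^ Suc j * real (n j)) = 6 * (\<Sum>j<J. s j * real (n j))"
      unfolding sum_distrib_left by (simp add: s_def)
    also have "ennreal \<dots> \<le> ennreal (6 * D)" using D[of J] by (intro ennreal_leI) simp
    finally show ?thesis .
  qed
  then have "(\<Sum>j. ennreal (l ^ Suc j * real (n j))) \<le> ennreal (6 * D)"
    by (intro suminf_le_const) auto
  then show ?thesis unfolding n_def s_def by (simp add: le_less_trans)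
qed

theorem theorem3p4:
  fixes E :: "riemann_sphere set"
  assumes "closedin riemann_sphere_topology E"
    and "\<not> (\<exists>C. sphere_circle C \<and> E \<subseteq> C)"
    and "\<exists>l::real. 0 < l \<and> l < 1 \<and>
           (\<Sum>j. ennreal (l ^ Suc j) * ennreal_of_enat (packing_number (l ^ Suc j) E)) = \<infinity>"
  shows "hyp_volume (CH E) = \<infinity>"
proof (rule ccontr)
  assume "hyp_volume (CH E) \<noteq> \<infinity>"
  then have fin: "hyp_volume (CH E) < \<infinity>" by (simp add: top.not_eq_extremum)
  obtain l :: real where l: "0 < l" "l < 1"
    and div: "(\<Sum>j. ennreal (l ^ Suc j) * ennreal_of_enat (packing_number (l ^ Suc j) E)) = \<infinity>"
    using assms(3) by blast
  let ?E' = "ideal_inversion ` E"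
  let ?a = "\<lambda>X j. ennreal (l ^ Suc j * real (sep_num (l ^ Suc j / 6) (disc_part X)))"
  have int: "interior (CH E) \<noteq> {}"
    using interior_para_CH_nonempty[OF assms(2)] interior_para_image_iff[OF CH_subset_hyp_space] by simp
  have "{q \<in> hyp_space. q \<in> CH E} \<subseteq> CH E" by blast
  then have "hyp_volume {q \<in> hyp_space. q \<in> CH E} < \<infinity>"
    by (rule le_less_trans[OF hyp_volume_mono fin])
  then have 1: "suminf (?a E) < \<infinity>"
    by (intro weighted_sep_num_sum_finite[where f = "\<lambda>q. q", OF int _ _ _ _ l]) auto
  \<comment> \<open>The volume at hand is that of \<open>CH E\<close>, so the hull of
    \<open>?E'\<close> is carried back into it.\<close>
  have "ideal_inversion ` ?E' = E" by (auto simp: image_image)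
  then have "{q \<in> hyp_space. inversion q \<in> CH ?E'} \<subseteq> CH E"
    using inversion_in_CH[of _ ?E'] by fastforce
  then have "hyp_volume {q \<in> hyp_space. inversion q \<in> CH ?E'} < \<infinity>"
    by (rule le_less_trans[OF hyp_volume_mono fin])
  then have 2: "suminf (?a ?E') < \<infinity>"
    by (intro weighted_sep_num_sum_finite[where f = inversion, OF interior_CH_inversion[OF int] _ _ _ _ l])
      (auto simp: inversion_in_hyp_space hyp_dist_inversion)
  have "ennreal (l ^ Suc j) * ennreal_of_enat (packing_number (l ^ Suc j) E) \<le> ?a E j + ?a ?E' j" for j
  proof -
    let ?n = "\<lambda>X. sep_num (l ^ Suc j / 6) (disc_part X)"
    have pos: "0 < l ^ Suc j" using l by simp
    have "ennreal_of_enat (packing_number (l ^ Suc j) E) \<le> ennreal_of_enat (enat (?n E + ?n ?E'))"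
      by (simp only: ennreal_of_enat_le_iff packing_number_le[OF pos])
    then have "ennreal (l ^ Suc j) * ennreal_of_enat (packing_number (l ^ Suc j) E)
        \<le> ennreal (l ^ Suc j) * ennreal (real (?n E + ?n ?E'))"
      by (intro mult_left_mono) (simp_all add: ennreal_of_nat_eq_real_of_nat)
    also have "\<dots> = ?a E j + ?a ?E' j"
      using pos by (subst ennreal_mult[symmetric]) (auto simp: distrib_left ennreal_plus)
    finally show ?thesis .
  qed
  then have "\<infinity> \<le> (\<Sum>j. ?a E j + ?a ?E' j)"
    unfolding div[symmetric] by (intro suminf_le) auto
  also have "\<dots> = suminf (?a E) + suminf (?a ?E')" by (intro suminf_add[symmetric]) auto
  also have "\<dots> < \<infinity>" using 1 2 by simp
  finally show False by simp
qed

end
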